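(* Let $T,K>0$, $n\in(0,\infty]$, let $G=(V,w,m)$ be a measured weighted graph with $\mathrm{Deg}_{\max}<\infty$, and let $\rho\colon V\to\mathbb{R}$ be such that $G$ satisfies $CD(\rho,n)$. Suppose $$k_T((\rho-K)_-)\le\frac14\left(1-e^{-KT/2}\right).$$ Then $$\operatorname{diam}(G)\le\frac{4\,\mathrm{Deg}_{\max}\,e^{KT/2}}{K}.$$
   Context: A measured weighted graph (mwg) $G=(V,w,m)$ consists of a countable set $V$, a symmetric function $w\colon V\times V\to[0,\infty)$ vanishing on the diagonal, and a function $m\colon V\to(0,\infty)$. All mwg are assumed locally finite (for each $x\in V$ the set $\{y: w(x,y)>0\}$ is finite) and connected. Write $q(x,y)=w(x,y)/m(x)$, $\mathrm{Deg}(x)=\sum_{y}q(x,y)$, $\mathrm{Deg}_{\max}=\sup_x\mathrm{Deg}(x)$. The combinatorial distance $d(x,y)$ is the smallest $n\in\mathbb{N}_0$ such that there are $x=x_0,\dots,x_n=y$ with $w(x_i,x_{i-1})>0$ for $i=1,\dots,n$; $\operatorname{diam}G=\sup_{x,y\in V}d(x,y)$. $L^2(V)$ carries the inner product $\langle f,g\rangle=\sum_{x}m(x)f(x)g(x)$. For $f\colon V\to\mathbb{R}$ the Laplacian is $\Delta f(x)=\sum_{y}q(x,y)(f(y)-f(x))$, and $L=-\Delta\ge0$ is the associated nonnegative self-adjoint operator on $L^2(V)$ (bounded when $\mathrm{Deg}_{\max}<\infty$). $P_t=e^{-tL}$, $t\ge0$, is the heat semigroup, extended as usual to bounded functions. For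 bounded $f,g\colon V\to\mathbb{R}$: $\Gamma(f,g)=\frac12(\Delta(fg)-f\Delta g-g\Delta f)$ and $\Gamma_2(f,g)=\frac12(\Delta\Gamma(f,g)-\Gamma(f,\Delta g)-\Gamma(g,\Delta f))$; $\Gamma f:=\Gamma(f,f)$, $\Gamma_2f:=\Gamma_2(f,f)$. $G$ satisfies $CD(\rho,n)$ if for all bounded $f\colon V\to\mathbb{R}$ and all $x\in V$: $\Gamma_2f(x)\ge\rho(x)\Gamma f(x)+\frac1n(\Delta f(x))^2$ (with $\frac1\infty=0$). For $a\in\mathbb{R}$, $a_-:=-\min\{0,a\}$. For $W\colon V\to[0,\infty)$ and $T>0$, $k_T(W):=\sup_{j\in\mathbb{N}}\int_0^T\|P_t(j\wedge W)\|_\infty\,dt$, where $j\wedge W$ is the pointwise minimum. *)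

theory Defs
  imports "HOL-Analysis.Analysis"
begin

text \<open>
  The vertex set of a measured weighted graph is the universe of a type of class
  \<^class>\<open>countable\<close>, which may be finite or infinite.
\<close>

locale measured_weighted_graph =
  fixes w :: "'v::countable \<Rightarrow> 'v \<Rightarrow> real" and m :: "'v \<Rightarrow> real"
  assumes weight_nonneg: "0 \<le> w x y"
    and weight_sym: "w x y = w y x"
    and weight_diag: "w x x = 0"
    and measure_pos: "0 < m x"
    and locally_finite: "finite {y. 0 < w x y}"
    and connected:
      "\<exists>n p. p 0 = x \<and> p n = y \<and> (\<forall>i\<in>{1..n::nat}. 0 < w (p i) (p (i - 1)))"

definition rate :: "('v \<Rightarrow> 'v \<Rightarrow> real) \<Rightarrow> ('v \<Rightarrow> real) \<Rightarrow> 'v \<Rightarrow> 'v \<Rightarrow> real" where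
  "rate w m x y = w x y / m x"

definition Deg :: "('v \<Rightarrow> 'v \<Rightarrow> real) \<Rightarrow> ('v \<Rightarrow> real) \<Rightarrow> 'v \<Rightarrow> real" where
  "Deg w m x = (\<Sum>\<^sub>\<infinity>y. rate w m x y)"

definition Deg_max :: "('v \<Rightarrow> 'v \<Rightarrow> real) \<Rightarrow> ('v \<Rightarrow> real) \<Rightarrow> ereal" where
  "Deg_max w m = (SUP x. ereal (Deg w m x))"

definition comb_dist :: "('v \<Rightarrow> 'v \<Rightarrow> real) \<Rightarrow> 'v \<Rightarrow> 'v \<Rightarrow> nat" where
  "comb_dist w x y =
     (LEAST n. \<exists>p. p 0 = x \<and> p n = y \<and> (\<forall>i\<in>{1..n}. 0 < w (p i) (p (i - 1))))"

definition diam :: "('v \<Rightarrow> 'v \<Rightarrow> real) \<Rightarrow> ereal" where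
  "diam w = (SUP x. SUP y. ereal (real (comb_dist w x y)))"

definition laplacian ::
  "('v \<Rightarrow> 'v \<Rightarrow> real) \<Rightarrow> ('v \<Rightarrow> real) \<Rightarrow> ('v \<Rightarrow> real) \<Rightarrow> 'v \<Rightarrow> real" where
  "laplacian w m f x = (\<Sum>\<^sub>\<infinity>y. rate w m x y * (f y - f x))"

definition L_op ::
  "('v \<Rightarrow> 'v \<Rightarrow> real) \<Rightarrow> ('v \<Rightarrow> real) \<Rightarrow> ('v \<Rightarrow> real) \<Rightarrow> 'v \<Rightarrow> real" where
  "L_op w m f x = - laplacian w m f x"

definition L2 :: "('v \<Rightarrow> real) \<Rightarrow> ('v \<Rightarrow> real) set" where
  "L2 m = {f. (\<lambda>x. m x * f x * f x) summable_on UNIV}"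

definition L2_inner :: "('v \<Rightarrow> real) \<Rightarrow> ('v \<Rightarrow> real) \<Rightarrow> ('v \<Rightarrow> real) \<Rightarrow> real" where
  "L2_inner m f g = (\<Sum>\<^sub>\<infinity>x. m x * f x * g x)"

definition L2_norm :: "('v \<Rightarrow> real) \<Rightarrow> ('v \<Rightarrow> real) \<Rightarrow> real" where
  "L2_norm m f = sqrt (L2_inner m f f)"

text \<open>
  The semigroup \<open>exp (- t L)\<close> on \<open>L2 m\<close>, as the \<open>L2\<close>-limit of the exponential series.
  This is meant for \<open>Deg_max w m < \<infinity>\<close> and \<open>f \<in> L2 m\<close>: then \<open>L\<close> is a bounded operator
  on \<open>L2 m\<close>, so all partial sums are in \<open>L2 m\<close> and the limit exists; it is unique
  because \<open>m\<close> is positive.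
\<close>

definition heat_L2 ::
  "('v \<Rightarrow> 'v \<Rightarrow> real) \<Rightarrow> ('v \<Rightarrow> real) \<Rightarrow> real \<Rightarrow> ('v \<Rightarrow> real) \<Rightarrow> 'v \<Rightarrow> real" where
  "heat_L2 w m t f =
     (THE g. g \<in> L2 m \<and>
        (\<lambda>N. L2_norm m (\<lambda>x. g x - (\<Sum>k<N. (- t) ^ k / fact k * (L_op w m ^^ k) f x)))
          \<longlonglongrightarrow> 0)"

definition heat_kernel ::
  "('v \<Rightarrow> 'v \<Rightarrow> real) \<Rightarrow> ('v \<Rightarrow> real) \<Rightarrow> real \<Rightarrow> 'v \<Rightarrow> 'v \<Rightarrow> real" where
  "heat_kernel w m t x y = heat_L2 w m t (indicator {y}) x / m y"

text \<open>
  The extension of the semigroup to bounded functions, by integration against the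
  heat kernel.
\<close>

definition heat ::
  "('v \<Rightarrow> 'v \<Rightarrow> real) \<Rightarrow> ('v \<Rightarrow> real) \<Rightarrow> real \<Rightarrow> ('v \<Rightarrow> real) \<Rightarrow> 'v \<Rightarrow> real" where
  "heat w m t f x = (\<Sum>\<^sub>\<infinity>y. heat_kernel w m t x y * f y * m y)"

definition Gamma ::
  "('v \<Rightarrow> 'v \<Rightarrow> real) \<Rightarrow> ('v \<Rightarrow> real) \<Rightarrow> ('v \<Rightarrow> real) \<Rightarrow> ('v \<Rightarrow> real) \<Rightarrow> 'v \<Rightarrow> real" where
  "Gamma w m f g x =
     1 / 2 * (laplacian w m (\<lambda>z. f z * g z) x - f x * laplacian w m g x
       - g x * laplacian w m f x)"

definition Gamma2 ::
  "('v \<Rightarrow> 'v \<Rightarrow> real) \<Rightarrow> ('v \<Rightarrow> real) \<Rightarrow> ('v \<Rightarrow> real) \<Rightarrow> ('v \<Rightarrow> real) \<Rightarrow> 'v \<Rightarrow> real" where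
  "Gamma2 w m f g x =
     1 / 2 * (laplacian w m (Gamma w m f g) x - Gamma w m f (laplacian w m g) x
       - Gamma w m g (laplacian w m f) x)"

text \<open>The dimension \<open>n\<close> may be \<open>\<infinity>\<close>; in \<^typ>\<open>ereal\<close>, \<open>1 / \<infinity> = 0\<close>.\<close>

definition CD ::
  "('v \<Rightarrow> 'v \<Rightarrow> real) \<Rightarrow> ('v \<Rightarrow> real) \<Rightarrow> ('v \<Rightarrow> real) \<Rightarrow> ereal \<Rightarrow> bool" where
  "CD w m \<rho> n \<longleftrightarrow>
     (\<forall>f x. bounded (range f) \<longrightarrow>
        ereal (Gamma2 w m f f x)
          \<ge> ereal (\<rho> x * Gamma w m f f x) + 1 / n * ereal ((laplacian w m f x)\<^sup>2))"

definition neg_part :: "real \<Rightarrow> real" where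
  "neg_part a = - min 0 a"

definition sup_norm :: "('v \<Rightarrow> real) \<Rightarrow> ennreal" where
  "sup_norm f = (SUP x. ennreal \<bar>f x\<bar>)"

definition k_T ::
  "('v \<Rightarrow> 'v \<Rightarrow> real) \<Rightarrow> ('v \<Rightarrow> real) \<Rightarrow> real \<Rightarrow> ('v \<Rightarrow> real) \<Rightarrow> ennreal" where
  "k_T w m T W =
     (SUP j::nat. \<integral>\<^sup>+t\<in>{0..T}. sup_norm (heat w m t (\<lambda>x. min (real j) (W x))) \<partial>lborel)"

end

theory Submission
  imports Defs
begin

text \<open>
  The heat semigroup smooths: if \<open>\<Gamma> (P\<^sub>t f)\<close> decays exponentially, then
  \<open>\<bar>\<partial>\<^sub>t P\<^sub>t f\<bar> = \<bar>\<Delta> P\<^sub>t f\<bar> \<le> sqrt (2 D \<Gamma> (P\<^sub>t f))\<close> is integrable in \<open>t\<close>, so \<open>f\<close> stays at bounded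
  distance from its limit under the flow, which is constant because its gradient vanishes and the
  graph is connected. Applied to a truncated distance function, for which \<open>\<Gamma> f \<le> D / 2\<close>, this
  bounds the diameter.

  Put \<open>W = (\<rho> - K)\<^sub>-\<close>. The curvature condition gives Bochner's inequality
  \<open>\<partial>\<^sub>t \<Gamma> (P\<^sub>t f) \<le> (\<Delta> - 2 K + 2 W) \<Gamma> (P\<^sub>t f)\<close>, and the issue is to absorb the potential \<open>2 W\<close>. The
  Kato condition bounds \<open>R t = \<integral>\<^sub>0\<^sup>t P\<^sub>s W ds\<close> by \<open>\<kappa> = (1 - exp (- K T / 2)) / 4\<close> for \<open>t \<le> T\<close>. If \<open>M\<close> is the
  supremum of \<open>U t = exp (2 K t) \<Gamma> (P\<^sub>t f)\<close> over \<open>[0, T]\<close>, the maximum principle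
  (\<open>maximum_principle\<close>) compares \<open>U\<close> with the solution \<open>sup (\<Gamma> f) + 2 M R t\<close> of the heat equation
  with source \<open>2 M W\<close>. Hence \<open>M \<le> sup (\<Gamma> f) + 2 M \<kappa>\<close>, that is \<open>M \<le> sup (\<Gamma> f) / (1 - 2 \<kappa>)\<close>
  (\<open>Gamma_exp_laplacian_le\<close>). By the choice of \<open>\<kappa>\<close>, the map \<open>P\<^sub>T\<close> then contracts the square root
  of \<open>sup \<Gamma>\<close> by \<open>exp (- K T / 2)\<close>, and the displacements under the iterates of \<open>P\<^sub>T\<close> sum to at most
  \<open>2 D / K\<close> (\<open>semigroup_step\<close>, \<open>oscillation_le\<close>). This yields the diameter bound \<open>4 D / K\<close>, a
  little sharper than the asserted one.

  Since the degree is bounded, \<open>\<Delta>\<close> is a bounded operator on bounded functions and \<open>P\<^sub>t\<close> is the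
  pointwise exponential series of \<open>t \<Delta>\<close>. Identifying this series with the semigroup built from the
  \<open>L\<^sup>2\<close> heat kernel (\<open>heat_eq_exp_laplacian\<close>) is what connects the argument with the Kato constant.
  Bounded degree also makes \<open>W\<close> bounded (\<open>bounded_if_k_T_finite\<close>), so the truncations
  in the Kato constant can be dropped.
\<close>

section \<open>Difference calculus on a graph of bounded degree\<close>

locale bounded_degree_graph = measured_weighted_graph w m
  for w :: "'v::countable \<Rightarrow> 'v \<Rightarrow> real" and m :: "'v \<Rightarrow> real" +
  fixes D :: real
  assumes Deg_le: "Deg w m x \<le> D"
begin

abbreviation nbrs :: "'v \<Rightarrow> 'v set" where "nbrs x \<equiv> {y. 0 < w x y}"
abbreviation q :: "'v \<Rightarrow> 'v \<Rightarrow> real" where "q \<equiv> rate w m"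
abbreviation \<Delta> :: "('v \<Rightarrow> real) \<Rightarrow> 'v \<Rightarrow> real" where "\<Delta> \<equiv> laplacian w m"
abbreviation \<Gamma> :: "('v \<Rightarrow> real) \<Rightarrow> 'v \<Rightarrow> real" where "\<Gamma> f \<equiv> Gamma w m f f"

lemma rate_nonneg: "0 \<le> q x y"
  using weight_nonneg[of x y] measure_pos[of x] by (simp add: rate_def)

lemma rate_eq_0: "y \<notin> nbrs x \<Longrightarrow> q x y = 0"
  using weight_nonneg[of x y] by (simp add: rate_def)

lemma infsum_rate: "(\<Sum>\<^sub>\<infinity>y. q x y * h y) = (\<Sum>y\<in>nbrs x. q x y * h y)"
proof -
  have "(\<Sum>\<^sub>\<infinity>y. q x y * h y) = (\<Sum>\<^sub>\<infinity>y\<in>nbrs x. q x y * h y)"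
    by (rule infsum_cong_neutral) (auto simp: rate_eq_0)
  then show ?thesis by (simp add: locally_finite)
qed

lemma laplacian_eq: "\<Delta> f x = (\<Sum>y\<in>nbrs x. q x y * (f y - f x))"
  unfolding laplacian_def by (rule infsum_rate)

lemma sum_rate_le: "(\<Sum>y\<in>nbrs x. q x y) \<le> D"
  using Deg_le[of x] infsum_rate[of x "\<lambda>_. 1"] by (simp add: Deg_def)

lemma D_nonneg: "0 \<le> D"
  using sum_rate_le[of undefined] sum_nonneg[of "nbrs undefined" "q undefined"]
  by (simp add: rate_nonneg)

lemma laplacian_diff: "\<Delta> (\<lambda>y. f y - g y) x = \<Delta> f x - \<Delta> g x"
  by (simp add: laplacian_eq algebra_simps sum.distrib sum_subtractf)

lemma laplacian_cmult: "\<Delta> (\<lambda>y. c * f y) x = c * \<Delta> f x"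
  by (simp add: laplacian_eq sum_distrib_left algebra_simps)

lemma laplacian_const: "\<Delta> (\<lambda>y. c) x = 0"
  by (simp add: laplacian_eq)

lemma Gamma_eq: "Gamma w m f g x = 1 / 2 * (\<Sum>y\<in>nbrs x. q x y * (f y - f x) * (g y - g x))"
proof -
  have "(\<Sum>y\<in>nbrs x. q x y * (f y * g y - f x * g x)) - f x * (\<Sum>y\<in>nbrs x. q x y * (g y - g x))
      - g x * (\<Sum>y\<in>nbrs x. q x y * (f y - f x))
    = (\<Sum>y\<in>nbrs x. q x y * (f y * g y - f x * g x) - f x * (q x y * (g y - g x))
      - g x * (q x y * (f y - f x)))"
    by (simp add: sum_subtractf sum_distrib_left)
  also have "\<dots> = (\<Sum>y\<in>nbrs x. q x y * (f y - f x) * (g y - g x))"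
    by (rule sum.cong) (auto simp: algebra_simps)
  finally show ?thesis by (simp add: Gamma_def laplacian_eq)
qed

lemma Gamma_square: "\<Gamma> f x = 1 / 2 * (\<Sum>y\<in>nbrs x. q x y * (f y - f x)\<^sup>2)"
  by (simp add: Gamma_eq power2_eq_square mult.assoc)

lemma Gamma_nonneg: "0 \<le> \<Gamma> f x"
  by (simp add: Gamma_square rate_nonneg sum_nonneg)

lemma Gamma_le:
  assumes "\<And>y. 0 < w x y \<Longrightarrow> \<bar>f y - f x\<bar> \<le> b" "0 \<le> b"
  shows "\<Gamma> f x \<le> D / 2 * b\<^sup>2"
proof -
  have "(\<Sum>y\<in>nbrs x. q x y * (f y - f x)\<^sup>2) \<le> (\<Sum>y\<in>nbrs x. q x y * b\<^sup>2)"
    using assms by (intro sum_mono mult_left_mono) (auto simp: rate_nonneg abs_le_square_iff[symmetric])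
  also have "\<dots> = (\<Sum>y\<in>nbrs x. q x y) * b\<^sup>2"
    by (simp add: sum_distrib_right)
  also have "\<dots> \<le> D * b\<^sup>2"
    by (intro mult_right_mono sum_rate_le) simp
  finally show ?thesis by (simp add: Gamma_square)
qed

lemma edge_le_Gamma:
  assumes "0 < w x y"
  shows "q x y * (f y - f x)\<^sup>2 \<le> 2 * \<Gamma> f x"
  using member_le_sum[of y "nbrs x" "\<lambda>y. q x y * (f y - f x)\<^sup>2"] assms
  by (simp add: Gamma_square rate_nonneg locally_finite)

lemma laplacian_square_le: "(\<Delta> f x)\<^sup>2 \<le> 2 * D * \<Gamma> f x"
proof -
  have "(\<Delta> f x)\<^sup>2 = (\<Sum>y\<in>nbrs x. sqrt (q x y) * (sqrt (q x y) * (f y - f x)))\<^sup>2"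
    unfolding laplacian_eq by (simp add: rate_nonneg flip: mult.assoc)
  also have "\<dots> \<le> (\<Sum>y\<in>nbrs x. (sqrt (q x y))\<^sup>2) * (\<Sum>y\<in>nbrs x. (sqrt (q x y) * (f y - f x))\<^sup>2)"
    by (rule Cauchy_Schwarz_ineq_sum)
  also have "\<dots> = (\<Sum>y\<in>nbrs x. q x y) * (2 * \<Gamma> f x)"
    by (simp add: power_mult_distrib rate_nonneg Gamma_square)
  also have "\<dots> \<le> D * (2 * \<Gamma> f x)"
    by (intro mult_right_mono sum_rate_le) (simp add: Gamma_nonneg)
  finally show ?thesis by (simp add: algebra_simps)
qed

lemma abs_laplacian_le:
  assumes "\<And>y. \<bar>f y\<bar> \<le> B"
  shows "\<bar>\<Delta> f x\<bar> \<le> 2 * D * B"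
proof -
  have B: "0 \<le> B" using assms[of x] by linarith
  have "\<bar>f y - f x\<bar> \<le> 2 * B" for y using assms[of y] assms[of x] by linarith
  then have "\<bar>\<Delta> f x\<bar> \<le> (\<Sum>y\<in>nbrs x. q x y * (2 * B))"
    unfolding laplacian_eq
    by (intro sum_abs[THEN order_trans] sum_mono) (auto simp: abs_mult rate_nonneg mult_left_mono)
  also have "\<dots> = (\<Sum>y\<in>nbrs x. q x y) * (2 * B)"
    by (simp add: sum_distrib_right)
  also have "\<dots> \<le> D * (2 * B)"
    using B by (intro mult_right_mono sum_rate_le) simp
  finally show ?thesis by simp
qed

text \<open>Local finiteness turns the Laplacian into a finite sum at each vertex, so differentiating
  under it requires no uniformity in the vertices.\<close>

lemma laplacian_has_derivative:
  assumes "\<And>y. ((\<lambda>t. u t y) has_real_derivative u' y) (at t)"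
  shows "((\<lambda>t. \<Delta> (u t) x) has_real_derivative \<Delta> u' x) (at t)"
  unfolding laplacian_eq by (intro DERIV_sum) (auto intro!: derivative_eq_intros assms)

lemma Gamma_has_derivative:
  assumes "\<And>y. ((\<lambda>t. u t y) has_real_derivative u' y) (at t)"
  shows "((\<lambda>t. \<Gamma> (u t) x) has_real_derivative 2 * Gamma w m (u t) u' x) (at t)"
proof -
  have "((\<lambda>t. \<Sum>y\<in>nbrs x. q x y * (u t y - u t x)\<^sup>2) has_real_derivative
     (\<Sum>y\<in>nbrs x. 2 * (q x y * (u t y - u t x) * (u' y - u' x)))) (at t)"
    by (intro DERIV_sum) (auto intro!: derivative_eq_intros assms)
  from DERIV_cmult[OF this, of "1/2"] show ?thesis
    by (simp add: Gamma_square Gamma_eq sum_distrib_left)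
qed

section \<open>The maximum principle\<close>

text \<open>The operator \<open>A = \<Delta> + D\<close> is positive and \<open>A 1 = D\<close>, because the total rate at each vertex is
  at most \<open>D\<close>. This replaces evaluation at a maximum, which need not be attained on an infinite
  graph.\<close>

lemma laplacian_plus_le:
  assumes "\<And>y. f y \<le> b" "0 \<le> b"
  shows "\<Delta> f x + D * f x \<le> D * b"
proof -
  let ?s = "\<Sum>y\<in>nbrs x. q x y"
  have "\<Delta> f x + D * f x = (\<Sum>y\<in>nbrs x. q x y * f y) + (D - ?s) * f x"
    by (simp add: laplacian_eq algebra_simps sum_subtractf sum_distrib_left)
  also have "\<dots> \<le> (\<Sum>y\<in>nbrs x. q x y * b) + (D - ?s) * b"
    using assms sum_rate_le[of x] by (intro add_mono sum_mono mult_left_mono) (auto simp: rate_nonneg)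
  also have "\<dots> = D * b" by (simp add: algebra_simps sum_distrib_left)
  finally show ?thesis .
qed

text \<open>Since \<open>exp (D t) Z\<close> has time derivative at most \<open>(\<Delta> + D) (exp (D t) Z)\<close>, each integration in
  time turns an upper bound \<open>C (D t)\<^sup>k / k!\<close> for it into \<open>C (D t)\<^sup>k\<^sup>+\<^sup>1 / (k + 1)!\<close>; the bounds
  tend to \<open>0\<close>.\<close>

lemma maximum_principle:
  assumes deriv: "\<And>t x. 0 \<le> t \<Longrightarrow> t \<le> T \<Longrightarrow> ((\<lambda>t. Z t x) has_real_derivative Z' t x) (at t)"
    and sub: "\<And>t x. 0 \<le> t \<Longrightarrow> t \<le> T \<Longrightarrow> Z' t x \<le> \<Delta> (Z t) x"
    and init: "\<And>x. Z 0 x \<le> 0"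
    and bdd: "\<And>t x. 0 \<le> t \<Longrightarrow> t \<le> T \<Longrightarrow> Z t x \<le> B"
    and t: "0 \<le> t" "t \<le> T"
  shows "Z t x \<le> 0"
proof -
  define C where "C = exp (D * T) * max B 0"
  have C: "0 \<le> C" by (simp add: C_def)
  have main: "exp (D * t) * Z t x \<le> C * ((D * t) ^ k / fact k)" if "0 \<le> t" "t \<le> T" for t x k
    using that
  proof (induction k arbitrary: t x)
    case 0
    have "exp (D * t) * Z t x \<le> exp (D * t) * max B 0"
      using bdd[OF 0, of x] by (intro mult_left_mono) auto
    also have "\<dots> \<le> exp (D * T) * max B 0"
      using 0 D_nonneg by (intro mult_right_mono) (auto intro: mult_left_mono)
    finally show ?case by (simp add: C_def)
  next
    case (Suc k)
    define Y where "Y s = exp (D * s) * Z s x - C * ((D * s) ^ Suc k / fact (Suc k))" for s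
    have "Y t \<le> Y 0"
    proof (rule DERIV_nonpos_imp_nonincreasing[OF Suc.prems(1)])
      fix s assume s: "0 \<le> s" "s \<le> t"
      then have sT: "s \<le> T" using Suc.prems by simp
      let ?y = "exp (D * s) * (Z' s x + D * Z s x) - C * (D * ((D * s) ^ k / fact k))"
      have pw: "((\<lambda>s. C * ((D * s) ^ Suc k / fact (Suc k))) has_real_derivative
          C * (D * ((D * s) ^ k / fact k))) (at s)"
      proof -
        have "((\<lambda>s. (D * s) ^ Suc k) has_real_derivative real (Suc k) * D * (D * s) ^ k) (at s)"
          using DERIV_power_Suc[OF DERIV_cmult_Id[of D s UNIV], of k] by (simp add: algebra_simps)
        then have "((\<lambda>s. C * ((D * s) ^ Suc k / fact (Suc k))) has_real_derivative
          C * ((real (Suc k) * D * (D * s) ^ k) / fact (Suc k))) (at s)"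
          by (intro DERIV_cmult DERIV_cdivide)
        moreover have "(real (Suc k) * D * (D * s) ^ k) / fact (Suc k) = D * ((D * s) ^ k / fact k)"
          by (simp del: of_nat_Suc)
        ultimately show ?thesis by simp
      qed
      have "DERIV Y s :> ?y"
        unfolding Y_def
        by (rule DERIV_diff[OF _ pw])
           (auto intro!: derivative_eq_intros deriv[OF s(1) sT] simp: algebra_simps)
      moreover have "?y \<le> 0"
      proof -
        define b where "b = exp (- D * s) * (C * ((D * s) ^ k / fact k))"
        have b: "exp (D * s) * b = C * ((D * s) ^ k / fact k)"
          unfolding b_def by (simp flip: mult.assoc exp_add)
        have "Z s y \<le> b" for y
          using Suc.IH[OF s(1) sT, of y] unfolding b[symmetric] by simp
        moreover have "0 \<le> b" using C D_nonneg s by (simp add: b_def)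
        ultimately have "Z' s x + D * Z s x \<le> D * b"
          using laplacian_plus_le[of "Z s" b x] sub[OF s(1) sT, of x] by simp
        then have "exp (D * s) * (Z' s x + D * Z s x) \<le> exp (D * s) * (D * b)"
          by (intro mult_left_mono) auto
        also have "\<dots> = C * (D * ((D * s) ^ k / fact k))"
          using b by (simp add: algebra_simps)
        finally show ?thesis by simp
      qed
      ultimately show "\<exists>y. DERIV Y s :> y \<and> y \<le> 0" by blast
    qed
    also have "Y 0 \<le> 0" using init[of x] by (simp add: Y_def)
    finally show ?case by (simp add: Y_def)
  qed
  have "(\<lambda>k. C * ((D * t) ^ k / fact k)) \<longlonglongrightarrow> C * 0"
    using summable_exp[of "D * t"]
    by (intro tendsto_mult tendsto_const) (auto dest: summable_LIMSEQ_zero simp: field_simps)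
  then have "exp (D * t) * Z t x \<le> C * 0"
    by (rule LIMSEQ_le_const) (use main t in auto)
  then show ?thesis by (simp add: mult_le_0_iff)
qed

section \<open>The exponential series of the Laplacian\<close>

text \<open>The series is taken vertex by vertex. For bounded \<open>f\<close> it is an everywhere convergent power
  series in \<open>t\<close>, which can be differentiated termwise.\<close>

definition exp_laplacian :: "real \<Rightarrow> ('v \<Rightarrow> real) \<Rightarrow> 'v \<Rightarrow> real" where
  "exp_laplacian t f x = (\<Sum>k. t ^ k / fact k * (\<Delta> ^^ k) f x)"

lemma abs_laplacian_power_le:
  assumes "\<And>y. \<bar>f y\<bar> \<le> B"
  shows "\<bar>(\<Delta> ^^ k) f x\<bar> \<le> (2 * D) ^ k * B"
proof (induction k arbitrary: x)
  case (Suc k)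
  show ?case using abs_laplacian_le[where f = "(\<Delta> ^^ k) f", OF Suc.IH, of x] by (simp add: mult.assoc)
qed (use assms in auto)

lemma abs_exp_laplacian_term_le:
  assumes "\<And>y. \<bar>f y\<bar> \<le> B"
  shows "\<bar>t ^ k / fact k * (\<Delta> ^^ k) f x\<bar> \<le> (2 * D * \<bar>t\<bar>) ^ k / fact k * B"
proof -
  have "\<bar>t ^ k / fact k * (\<Delta> ^^ k) f x\<bar> \<le> \<bar>t\<bar> ^ k / fact k * ((2 * D) ^ k * B)"
    unfolding abs_mult using abs_laplacian_power_le[where f = f, OF assms, of k x]
    by (intro mult_mono) (auto simp: power_abs)
  then show ?thesis by (simp add: power_mult_distrib mult_ac)
qed

lemma exp_sums: "(\<lambda>k. (c::real) ^ k / fact k) sums exp c"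
  using exp_converges[of c] by (simp add: field_simps)

lemma summable_exp_laplacian_norm:
  assumes "\<And>y. \<bar>f y\<bar> \<le> B"
  shows "summable (\<lambda>k. \<bar>t ^ k / fact k * (\<Delta> ^^ k) f x\<bar>)"
proof (rule summable_comparison_test')
  show "summable (\<lambda>k. (2 * D * \<bar>t\<bar>) ^ k / fact k * B)"
    using exp_sums by (intro summable_mult2) (auto simp: sums_iff)
qed (use abs_exp_laplacian_term_le[where f = f, OF assms] in simp)

lemma summable_exp_laplacian:
  assumes "\<And>y. \<bar>f y\<bar> \<le> B"
  shows "summable (\<lambda>k. t ^ k / fact k * (\<Delta> ^^ k) f x)"
  using summable_exp_laplacian_norm[where f = f, OF assms] by (rule summable_rabs_cancel)

lemma abs_exp_laplacian_le:
  assumes "\<And>y. \<bar>f y\<bar> \<le> B"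
  shows "\<bar>exp_laplacian t f x\<bar> \<le> exp (2 * D * \<bar>t\<bar>) * B"
proof -
  note s = sums_mult2[OF exp_sums[of "2 * D * \<bar>t\<bar>"], of B]
  have "\<bar>exp_laplacian t f x\<bar> \<le> (\<Sum>k. \<bar>t ^ k / fact k * (\<Delta> ^^ k) f x\<bar>)"
    unfolding exp_laplacian_def by (rule summable_rabs[OF summable_exp_laplacian_norm[where f = f, OF assms]])
  also have "\<dots> \<le> (\<Sum>k. (2 * D * \<bar>t\<bar>) ^ k / fact k * B)"
    using s by (intro suminf_le abs_exp_laplacian_term_le[where f = f, OF assms] summable_exp_laplacian_norm[where f = f, OF assms])
      (auto simp: sums_iff)
  finally show ?thesis using s by (simp add: sums_iff)
qed

lemma exp_laplacian_0: "exp_laplacian 0 f x = f x"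
  using sums_unique[OF powser_sums_zero[of "\<lambda>k. (\<Delta> ^^ k) f x / fact k"]]
  by (simp add: exp_laplacian_def mult_ac)

lemma laplacian_exp_laplacian:
  assumes "\<And>y. \<bar>f y\<bar> \<le> B"
  shows "\<Delta> (exp_laplacian t f) x = (\<Sum>k. t ^ k / fact k * (\<Delta> ^^ Suc k) f x)"
proof -
  have "(\<lambda>k. q x y * (t ^ k / fact k * (\<Delta> ^^ k) f y - t ^ k / fact k * (\<Delta> ^^ k) f x)) sums
      (q x y * (exp_laplacian t f y - exp_laplacian t f x))" for y
    unfolding exp_laplacian_def
    by (intro sums_mult sums_diff summable_sums summable_exp_laplacian[where f = f, OF assms])
  then have "(\<lambda>k. \<Sum>y\<in>nbrs x. q x y * (t ^ k / fact k * (\<Delta> ^^ k) f y - t ^ k / fact k * (\<Delta> ^^ k) f x))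
      sums \<Delta> (exp_laplacian t f) x"
    unfolding laplacian_eq by (intro sums_sum)
  moreover have "(\<Sum>y\<in>nbrs x. q x y * (t ^ k / fact k * (\<Delta> ^^ k) f y - t ^ k / fact k * (\<Delta> ^^ k) f x))
      = t ^ k / fact k * (\<Delta> ^^ Suc k) f x" for k
    by (simp add: laplacian_eq sum_distrib_left algebra_simps)
  ultimately show ?thesis by (simp add: sums_iff)
qed

lemma exp_laplacian_has_derivative:
  assumes "\<And>y. \<bar>f y\<bar> \<le> B"
  shows "((\<lambda>t. exp_laplacian t f x) has_real_derivative \<Delta> (exp_laplacian t f) x) (at t)"
proof -
  define c where "c k = (\<Delta> ^^ k) f x / fact k" for k
  have "summable (\<lambda>k. c k * s ^ k)" for s
    using summable_exp_laplacian[where f = f, OF assms, of s x] by (simp add: c_def mult_ac)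
  then have "((\<lambda>t. \<Sum>k. c k * t ^ k) has_real_derivative (\<Sum>k. diffs c k * t ^ k)) (at t)"
    by (rule termdiffs_strong_converges_everywhere)
  moreover have "diffs c k = (\<Delta> ^^ Suc k) f x / fact k" for k
    by (simp add: diffs_def c_def del: of_nat_Suc)
  ultimately show ?thesis
    unfolding laplacian_exp_laplacian[where f = f, OF assms] by (simp add: exp_laplacian_def c_def mult_ac)
qed

lemma exp_laplacian_nonneg:
  assumes "\<And>y. 0 \<le> f y" "\<And>y. f y \<le> B" "0 \<le> t"
  shows "0 \<le> exp_laplacian t f x"
proof -
  have f: "\<bar>f y\<bar> \<le> B" for y using assms(1,2)[of y] by simp
  have "B \<ge> 0" using f[of x] by linarith
  have "- exp_laplacian t f x \<le> 0"
  proof (rule maximum_principle[where T = t and B = "exp (2 * D * t) * B"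
        and Z = "\<lambda>t x. - exp_laplacian t f x" and Z' = "\<lambda>t x. - \<Delta> (exp_laplacian t f) x"])
    fix s x assume s: "0 \<le> s" "s \<le> t"
    have "\<bar>exp_laplacian s f x\<bar> \<le> exp (2 * D * s) * B"
      using abs_exp_laplacian_le[where f = f, OF f, of s x] s by simp
    also have "\<dots> \<le> exp (2 * D * t) * B"
      using s D_nonneg \<open>B \<ge> 0\<close> by (intro mult_right_mono) (auto intro: mult_left_mono)
    finally show "- exp_laplacian s f x \<le> exp (2 * D * t) * B" by linarith
    show "- \<Delta> (exp_laplacian s f) x \<le> \<Delta> (\<lambda>x. - exp_laplacian s f x) x"
      using laplacian_cmult[of "-1" "exp_laplacian s f" x] by simp
    show "((\<lambda>t. - exp_laplacian t f x) has_real_derivative - \<Delta> (exp_laplacian s f) x) (at s)"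
      by (intro DERIV_minus exp_laplacian_has_derivative[where f = f, OF f])
  qed (use assms in \<open>auto simp: exp_laplacian_0\<close>)
  then show ?thesis by simp
qed

text \<open>The random walk stays put up to time \<open>t\<close> with probability at least \<open>exp (- D t)\<close>.\<close>

lemma exp_laplacian_lower_bound:
  assumes f: "\<And>y. 0 \<le> f y" "\<And>y. f y \<le> B" and "0 \<le> t"
  shows "exp (- D * t) * f x \<le> exp_laplacian t f x"
proof -
  have f': "\<bar>f y\<bar> \<le> B" for y using f[of y] by simp
  have "exp (D * 0) * exp_laplacian 0 f x \<le> exp (D * t) * exp_laplacian t f x"
  proof (rule DERIV_nonneg_imp_nondecreasing[OF \<open>0 \<le> t\<close>])
    fix s assume s: "0 \<le> s" "s \<le> t"
    let ?g = "exp_laplacian s f"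
    have "((\<lambda>s. exp (D * s) * exp_laplacian s f x) has_real_derivative
        exp (D * s) * (\<Delta> ?g x + D * ?g x)) (at s)"
      by (auto intro!: derivative_eq_intros exp_laplacian_has_derivative[where f = f, OF f'] simp: algebra_simps)
    moreover have "0 \<le> \<Delta> ?g x + D * ?g x"
      using laplacian_plus_le[of "\<lambda>y. - 1 * ?g y" 0 x] exp_laplacian_nonneg[where f = f, OF f s(1)]
      unfolding laplacian_cmult by simp
    ultimately show "\<exists>y. ((\<lambda>s. exp (D * s) * exp_laplacian s f x) has_real_derivative y) (at s) \<and> 0 \<le> y"
      by (metis exp_ge_zero mult_nonneg_nonneg)
  qed
  then have "exp (- D * t) * f x \<le> exp (- D * t) * (exp (D * t) * exp_laplacian t f x)"
    by (intro mult_left_mono) (auto simp: exp_laplacian_0)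
  also have "\<dots> = exp_laplacian t f x" by (simp flip: mult.assoc exp_add)
  finally show ?thesis .
qed

end

section \<open>The heat semigroup is the exponential series\<close>

lemma L2_diff:
  assumes m: "\<And>x. 0 \<le> m x" and "f \<in> L2 m" "g \<in> L2 m"
  shows "(\<lambda>x. f x - g x) \<in> L2 m"
proof -
  have "(\<lambda>x. 2 * (m x * f x * f x) + 2 * (m x * g x * g x)) summable_on UNIV"
    using assms by (intro summable_on_add summable_on_cmult_right) (auto simp: L2_def)
  moreover have "m x * (f x - g x) * (f x - g x) \<le> 2 * (m x * f x * f x) + 2 * (m x * g x * g x)" for x
    using mult_nonneg_nonneg[OF m[of x] zero_le_square[of "f x + g x"]] by (simp add: algebra_simps)
  moreover have "0 \<le> m x * (f x - g x) * (f x - g x)" for x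
    using mult_nonneg_nonneg[OF m[of x] zero_le_square[of "f x - g x"]] by (simp add: mult.assoc)
  ultimately show ?thesis
    unfolding L2_def by (auto intro: summable_on_comparison_test)
qed

lemma abs_le_L2_norm:
  assumes m: "\<And>x. 0 \<le> m x" and "f \<in> L2 m"
  shows "sqrt (m x) * \<bar>f x\<bar> \<le> L2_norm m f"
proof -
  have "0 \<le> m x * f x * f x" for x
    using mult_nonneg_nonneg[OF m[of x] zero_le_square[of "f x"]] by (simp add: mult.assoc)
  then have "m x * f x * f x \<le> L2_inner m f f"
    using assms finite_sum_le_infsum[of "\<lambda>x. m x * f x * f x" UNIV "{x}"]
    by (simp add: L2_inner_def L2_def)
  then have "sqrt (m x * f x * f x) \<le> L2_norm m f"
    by (simp add: L2_norm_def)
  then show ?thesis by (simp add: real_sqrt_mult mult.assoc)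
qed

text \<open>Interpolation between \<open>\<ell>\<^sup>1(m)\<close> and \<open>\<ell>\<^sup>\<infinity>\<close>: one factor of the square is
  bounded by \<open>E\<close>, the other is summed.\<close>

lemma L2_norm_le_if_bounded:
  assumes m: "\<And>x. 0 \<le> m x"
    and sup: "\<And>x. \<bar>f x\<bar> \<le> E"
    and l1: "\<And>F. finite F \<Longrightarrow> (\<Sum>x\<in>F. m x * \<bar>f x\<bar>) \<le> E * c"
  shows "f \<in> L2 m" "L2_norm m f \<le> E * sqrt c"
proof -
  have E: "0 \<le> E" using sup[of undefined] by linarith
  have sq: "m x * f x * f x = m x * \<bar>f x\<bar> * \<bar>f x\<bar>" for x by (simp add: mult.assoc)
  have fin: "(\<Sum>x\<in>F. m x * f x * f x) \<le> E * c * E" if "finite F" for F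
  proof -
    have "(\<Sum>x\<in>F. m x * f x * f x) \<le> (\<Sum>x\<in>F. m x * \<bar>f x\<bar> * E)"
      unfolding sq using m sup by (intro sum_mono mult_left_mono) auto
    also have "\<dots> \<le> E * c * E"
      unfolding sum_distrib_right[symmetric] using l1[OF that] E by (intro mult_right_mono)
    finally show ?thesis .
  qed
  have s: "(\<lambda>x. m x * f x * f x) summable_on UNIV"
    by (rule nonneg_bdd_above_summable_on) (use m fin in \<open>auto simp: sq intro!: bdd_aboveI\<close>)
  then show "f \<in> L2 m" by (simp add: L2_def)
  have "L2_inner m f f \<le> E * c * E"
    unfolding L2_inner_def by (rule infsum_le_finite_sums[OF s fin])
  then have "L2_norm m f \<le> sqrt (E * E * c)"
    unfolding L2_norm_def by (simp add: mult_ac)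
  then show "L2_norm m f \<le> E * sqrt c"
    using E by (simp add: real_sqrt_mult)
qed

lemma has_sum_finite_sum:
  fixes f :: "'i \<Rightarrow> 'a \<Rightarrow> 'b::topological_comm_monoid_add"
  assumes "finite I" "\<And>i. i \<in> I \<Longrightarrow> (f i has_sum s i) A"
  shows "((\<lambda>x. \<Sum>i\<in>I. f i x) has_sum (\<Sum>i\<in>I. s i)) A"
  using assms by (induction I) (auto intro: has_sum_add)

context bounded_degree_graph
begin

abbreviation delta_fn :: "'v \<Rightarrow> 'v \<Rightarrow> real" where "delta_fn y \<equiv> indicator {y}"

lemma sum_rate_finite_le:
  assumes "finite F"
  shows "(\<Sum>y\<in>F. q x y) \<le> D"
proof -
  have "(\<Sum>y\<in>F. q x y) = (\<Sum>y\<in>F \<inter> nbrs x. q x y)"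
    using assms by (intro sum.mono_neutral_right) (auto simp: rate_eq_0)
  also have "\<dots> \<le> (\<Sum>y\<in>nbrs x. q x y)"
    by (intro sum_mono2) (auto simp: locally_finite rate_nonneg)
  finally show ?thesis using sum_rate_le[of x] by linarith
qed

lemma measure_rate: "m x * q x y = w x y"
  using measure_pos[of x] by (simp add: rate_def)

text \<open>By symmetry of \<open>w\<close>, the measure \<open>m\<close> is reversible, so \<open>\<Delta>\<close> is bounded on
  \<open>\<ell>\<^sup>1(m)\<close> as it is on \<open>\<ell>\<^sup>\<infinity>\<close>.\<close>

lemma sum_measure_laplacian_le:
  assumes g: "\<And>F. finite F \<Longrightarrow> (\<Sum>x\<in>F. m x * \<bar>g x\<bar>) \<le> B" and F: "finite F"
  shows "(\<Sum>x\<in>F. m x * \<bar>\<Delta> g x\<bar>) \<le> 2 * D * B"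
proof -
  define N where "N = (\<Union>x\<in>F. nbrs x)"
  have N: "finite N" using F locally_finite by (simp add: N_def)
  have m: "0 \<le> m x" for x using measure_pos[of x] by simp
  have "m x * \<bar>\<Delta> g x\<bar> \<le> (\<Sum>y\<in>N. w x y * \<bar>g y\<bar>) + D * (m x * \<bar>g x\<bar>)" if "x \<in> F" for x
  proof -
    have "\<bar>\<Delta> g x\<bar> \<le> (\<Sum>y\<in>nbrs x. q x y * (\<bar>g y\<bar> + \<bar>g x\<bar>))"
      unfolding laplacian_eq
      by (intro sum_abs[THEN order_trans] sum_mono) (auto simp: abs_mult rate_nonneg intro!: mult_left_mono)
    also have "\<dots> = (\<Sum>y\<in>nbrs x. q x y * \<bar>g y\<bar>) + (\<Sum>y\<in>nbrs x. q x y) * \<bar>g x\<bar>"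
      by (simp add: algebra_simps sum.distrib sum_distrib_left)
    also have "\<dots> \<le> (\<Sum>y\<in>N. q x y * \<bar>g y\<bar>) + D * \<bar>g x\<bar>"
      using that N by (intro add_mono sum_mono2 mult_right_mono sum_rate_le) (auto simp: N_def rate_nonneg)
    finally have "m x * \<bar>\<Delta> g x\<bar> \<le> m x * ((\<Sum>y\<in>N. q x y * \<bar>g y\<bar>) + D * \<bar>g x\<bar>)"
      by (intro mult_left_mono m)
    also have "\<dots> = (\<Sum>y\<in>N. w x y * \<bar>g y\<bar>) + D * (m x * \<bar>g x\<bar>)"
      by (simp add: distrib_left sum_distrib_left measure_rate flip: mult.assoc)
    finally show ?thesis .
  qed
  then have "(\<Sum>x\<in>F. m x * \<bar>\<Delta> g x\<bar>) \<le> (\<Sum>x\<in>F. (\<Sum>y\<in>N. w x y * \<bar>g y\<bar>) + D * (m x * \<bar>g x\<bar>))"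
    by (rule sum_mono)
  also have "\<dots> = (\<Sum>y\<in>N. \<Sum>x\<in>F. w x y * \<bar>g y\<bar>) + D * (\<Sum>x\<in>F. m x * \<bar>g x\<bar>)"
    by (simp add: sum.distrib sum_distrib_left sum.swap[of _ N F])
  also have "(\<Sum>y\<in>N. \<Sum>x\<in>F. w x y * \<bar>g y\<bar>) = (\<Sum>y\<in>N. m y * \<bar>g y\<bar> * (\<Sum>x\<in>F. q y x))"
    unfolding sum_distrib_left
    by (intro sum.cong refl) (metis (no_types) measure_rate mult.assoc mult.commute weight_sym)
  also have "\<dots> \<le> (\<Sum>y\<in>N. m y * \<bar>g y\<bar> * D)"
    using m by (intro sum_mono mult_left_mono sum_rate_finite_le F) auto
  also have "\<dots> = D * (\<Sum>y\<in>N. m y * \<bar>g y\<bar>)"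
    by (simp add: sum_distrib_left mult_ac)
  finally have "(\<Sum>x\<in>F. m x * \<bar>\<Delta> g x\<bar>) \<le> D * (\<Sum>y\<in>N. m y * \<bar>g y\<bar>) + D * (\<Sum>x\<in>F. m x * \<bar>g x\<bar>)"
    by simp
  also have "\<dots> \<le> D * B + D * B"
    by (intro add_mono mult_left_mono g N F D_nonneg)
  finally show ?thesis by (simp add: mult_ac)
qed

lemma sum_measure_laplacian_power_le:
  assumes "finite F"
  shows "(\<Sum>x\<in>F. m x * \<bar>(\<Delta> ^^ k) (delta_fn y) x\<bar>) \<le> (2 * D) ^ k * m y"
  using assms
proof (induction k arbitrary: F)
  case 0
  have "(\<Sum>x\<in>F. m x * \<bar>delta_fn y x\<bar>) = (\<Sum>x\<in>F. if x = y then m y else 0)"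
    by (rule sum.cong) (auto simp: indicator_def)
  then show ?case using 0 measure_pos[of y] by simp
next
  case (Suc k)
  show ?case
    using sum_measure_laplacian_le[OF Suc.IH Suc.prems] by (simp add: mult.assoc)
qed

lemma sum_laplacian_power_row_le:
  assumes F: "finite F"
  shows "(\<Sum>y\<in>F. \<bar>(\<Delta> ^^ k) (delta_fn y) x\<bar>) \<le> (2 * D) ^ k"
proof (induction k arbitrary: x)
  case 0
  have "(\<Sum>y\<in>F. \<bar>delta_fn y x\<bar>) = (\<Sum>y\<in>F. if x = y then 1 else 0)"
    by (rule sum.cong) (auto simp: indicator_def)
  then show ?case using F by simp
next
  case (Suc k)
  define a where "a z y = (\<Delta> ^^ k) (delta_fn y) z" for z y
  have "(\<Sum>y\<in>F. \<bar>(\<Delta> ^^ Suc k) (delta_fn y) x\<bar>)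
      \<le> (\<Sum>y\<in>F. \<Sum>z\<in>nbrs x. q x z * (\<bar>a z y\<bar> + \<bar>a x y\<bar>))"
    unfolding funpow.simps o_def laplacian_eq a_def
    by (intro sum_mono sum_abs[THEN order_trans]) (auto simp: abs_mult rate_nonneg intro!: mult_left_mono)
  also have "\<dots> = (\<Sum>z\<in>nbrs x. q x z * ((\<Sum>y\<in>F. \<bar>a z y\<bar>) + (\<Sum>y\<in>F. \<bar>a x y\<bar>)))"
    by (simp add: sum.swap[of _ F] sum_distrib_left distrib_left sum.distrib)
  also have "\<dots> \<le> (\<Sum>z\<in>nbrs x. q x z * ((2 * D) ^ k + (2 * D) ^ k))"
    unfolding a_def by (intro sum_mono mult_left_mono add_mono Suc.IH rate_nonneg)
  also have "\<dots> = (\<Sum>z\<in>nbrs x. q x z) * (2 * (2 * D) ^ k)"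
    unfolding sum_distrib_right by (intro sum.cong) auto
  also have "\<dots> \<le> D * (2 * (2 * D) ^ k)"
    using D_nonneg by (intro mult_right_mono sum_rate_le) simp
  finally show ?case by simp
qed

lemma has_sum_laplacian_power:
  "((\<lambda>y. (\<Delta> ^^ k) (delta_fn y) x * f y) has_sum (\<Delta> ^^ k) f x) UNIV"
proof (induction k arbitrary: x)
  case 0
  show ?case by (rule has_sum_finite_neutralI[of "{x}"]) (auto simp: indicator_def)
next
  case (Suc k)
  have "((\<lambda>y. \<Sum>z\<in>nbrs x. q x z * ((\<Delta> ^^ k) (delta_fn y) z * f y) + - q x z * ((\<Delta> ^^ k) (delta_fn y) x * f y))
      has_sum (\<Sum>z\<in>nbrs x. q x z * (\<Delta> ^^ k) f z + - q x z * (\<Delta> ^^ k) f x)) UNIV"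
    by (intro has_sum_finite_sum has_sum_add has_sum_cmult_right Suc.IH locally_finite)
  moreover have "(\<Sum>z\<in>nbrs x. q x z * ((\<Delta> ^^ k) (delta_fn y) z * f y) + - q x z * ((\<Delta> ^^ k) (delta_fn y) x * f y))
     = (\<Delta> ^^ Suc k) (delta_fn y) x * f y" for y
    unfolding funpow.simps o_def laplacian_eq sum_distrib_right
    by (intro sum.cong) (auto simp: algebra_simps)
  moreover have "(\<Sum>z\<in>nbrs x. q x z * (\<Delta> ^^ k) f z + - q x z * (\<Delta> ^^ k) f x) = (\<Delta> ^^ Suc k) f x"
    unfolding funpow.simps o_def laplacian_eq by (intro sum.cong) (auto simp: algebra_simps)
  ultimately show ?case by simp
qed

lemma L_op_power: "(L_op w m ^^ k) f x = (- 1) ^ k * (\<Delta> ^^ k) f x"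
proof (induction k arbitrary: x)
  case (Suc k)
  then have "(L_op w m ^^ k) f = (\<lambda>x. (- 1) ^ k * (\<Delta> ^^ k) f x)" by blast
  then show ?case by (simp add: L_op_def[of w m "\<lambda>x. (- 1) ^ k * (\<Delta> ^^ k) f x"] laplacian_cmult)
qed simp

text \<open>The \<open>L\<^sup>2\<close>-limit that defines the heat semigroup on point masses is the pointwise limit:
  the remainders of the exponential series are small in \<open>\<ell>\<^sup>1(m)\<close> and in \<open>\<ell>\<^sup>\<infinity>\<close>, hence in
  \<open>L\<^sup>2(m)\<close>, and convergence in \<open>L\<^sup>2(m)\<close> determines every value because \<open>m\<close> is positive.\<close>

lemma heat_L2_delta: "heat_L2 w m t (delta_fn y) = exp_laplacian t (delta_fn y)"
proof -
  define b where "b k x = t ^ k / fact k * (\<Delta> ^^ k) (delta_fn y) x" for k x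
  define E where "E k = (2 * D * \<bar>t\<bar>) ^ k / fact k" for k :: nat
  define S where "S N x = (\<Sum>k<N. b k x)" for N x
  define r where "r N x = exp_laplacian t (delta_fn y) x - S N x" for N x
  define \<epsilon> where "\<epsilon> N = (\<Sum>k. E (k + N))" for N
  have m: "0 \<le> m x" for x using measure_pos[of x] by simp
  have S_eq: "(\<Sum>k<N. (- t) ^ k / fact k * (L_op w m ^^ k) (delta_fn y) x) = S N x" for N x
    unfolding S_def b_def L_op_power
  proof (intro sum.cong refl)
    fix k
    have "(- t) ^ k * (- 1) ^ k = t ^ k" by (simp flip: power_mult_distrib)
    then show "(- t) ^ k / fact k * ((- 1) ^ k * (\<Delta> ^^ k) (delta_fn y) x)
        = t ^ k / fact k * (\<Delta> ^^ k) (delta_fn y) x"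
      by (simp add: field_simps)
  qed
  have one: "\<bar>delta_fn y x\<bar> \<le> 1" for x by (simp add: indicator_def)
  have b_le: "\<bar>b k x\<bar> \<le> E k" for k x
    using abs_exp_laplacian_term_le[where f = "delta_fn y", OF one, of t k x] by (simp add: b_def E_def)
  have sb: "summable (\<lambda>k. b k x)" "summable (\<lambda>k. \<bar>b k x\<bar>)" for x
    using summable_exp_laplacian[where f = "delta_fn y", OF one, of t x]
      summable_exp_laplacian_norm[where f = "delta_fn y", OF one, of t x] by (simp_all add: b_def)
  have sE: "summable E" using exp_sums[of "2 * D * \<bar>t\<bar>"] by (simp add: E_def[abs_def] sums_iff)
  have sb': "summable (\<lambda>k. \<bar>b (k + N) x\<bar>)" for x N
    using sb(2)[of x] by (subst summable_iff_shift)
  have sE': "summable (\<lambda>k. E (k + N))" for N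
    using sE by (subst summable_iff_shift)
  have r_le: "\<bar>r N x\<bar> \<le> (\<Sum>k. \<bar>b (k + N) x\<bar>)" for N x
  proof -
    have "r N x = (\<Sum>k. b (k + N) x)"
      using suminf_split_initial_segment[OF sb(1), of x N]
      by (simp add: r_def S_def exp_laplacian_def b_def)
    then show ?thesis using summable_rabs[OF sb'] by simp
  qed
  have r_sup: "\<bar>r N x\<bar> \<le> \<epsilon> N" for N x
    using r_le[of N x] suminf_le[OF b_le[of "_ + N" x] sb' sE'] by (simp add: \<epsilon>_def)
  have r_l1: "(\<Sum>x\<in>F. m x * \<bar>r N x\<bar>) \<le> \<epsilon> N * m y" if F: "finite F" for N F
  proof -
    have "(\<Sum>x\<in>F. m x * \<bar>r N x\<bar>) \<le> (\<Sum>x\<in>F. m x * (\<Sum>k. \<bar>b (k + N) x\<bar>))"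
      by (intro sum_mono mult_left_mono r_le m)
    also have "(\<lambda>k. \<Sum>x\<in>F. m x * \<bar>b (k + N) x\<bar>) sums \<dots>"
      by (intro sums_sum sums_mult summable_sums sb')
    then have "(\<Sum>x\<in>F. m x * (\<Sum>k. \<bar>b (k + N) x\<bar>)) = (\<Sum>k. \<Sum>x\<in>F. m x * \<bar>b (k + N) x\<bar>)"
      and "summable (\<lambda>k. \<Sum>x\<in>F. m x * \<bar>b (k + N) x\<bar>)"
      by (simp_all add: sums_iff)
    note this(1)
    also have "(\<Sum>k. \<Sum>x\<in>F. m x * \<bar>b (k + N) x\<bar>) \<le> (\<Sum>k. E (k + N) * m y)"
    proof (rule suminf_le)
      fix k
      have "(\<Sum>x\<in>F. m x * \<bar>b (k + N) x\<bar>)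
          = \<bar>t\<bar> ^ (k + N) / fact (k + N) * (\<Sum>x\<in>F. m x * \<bar>(\<Delta> ^^ (k + N)) (delta_fn y) x\<bar>)"
        unfolding b_def sum_distrib_left
        by (intro sum.cong refl) (simp add: abs_mult power_abs mult_ac)
      also have "\<dots> \<le> \<bar>t\<bar> ^ (k + N) / fact (k + N) * ((2 * D) ^ (k + N) * m y)"
        by (intro mult_left_mono sum_measure_laplacian_power_le F) auto
      also have "\<dots> = E (k + N) * m y"
        by (simp add: E_def power_mult_distrib mult_ac)
      finally show "(\<Sum>x\<in>F. m x * \<bar>b (k + N) x\<bar>) \<le> E (k + N) * m y" .
    qed (use \<open>summable (\<lambda>k. \<Sum>x\<in>F. m x * \<bar>b (k + N) x\<bar>)\<close> in \<open>auto intro: summable_mult2 sE'\<close>)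
    also have "\<dots> = \<epsilon> N * m y" unfolding \<epsilon>_def by (rule suminf_mult2[OF sE', symmetric])
    finally show ?thesis .
  qed
  note r_L2 = L2_norm_le_if_bounded[where f = "r N" and m = m for N, OF m r_sup r_l1]
  have "\<epsilon> = (\<lambda>N. suminf E - (\<Sum>k<N. E k))"
    using suminf_split_initial_segment[OF sE] by (intro ext) (simp add: \<epsilon>_def eq_diff_eq)
  moreover have "(\<lambda>N. suminf E - (\<Sum>k<N. E k)) \<longlonglongrightarrow> suminf E - suminf E"
    by (intro tendsto_diff tendsto_const summable_LIMSEQ sE)
  ultimately have \<epsilon>_lim: "\<epsilon> \<longlonglongrightarrow> 0" by simp
  have e_L2: "exp_laplacian t (delta_fn y) \<in> L2 m"
    using r_L2(1)[of 0] by (simp add: r_def[abs_def] S_def)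
  show ?thesis
    unfolding heat_L2_def S_eq
  proof (rule the_equality, intro conjI e_L2)
    have "(\<lambda>N. L2_norm m (r N)) \<longlonglongrightarrow> 0"
    proof (rule tendsto_sandwich[OF _ _ tendsto_const])
      show "(\<lambda>N. \<epsilon> N * sqrt (m y)) \<longlonglongrightarrow> 0" using tendsto_mult_right[OF \<epsilon>_lim] by simp
      show "\<forall>\<^sub>F N in sequentially. 0 \<le> L2_norm m (r N)"
        using abs_le_L2_norm[OF m r_L2(1), of y] m[of y]
        by (intro always_eventually allI) (meson abs_ge_zero mult_nonneg_nonneg order_trans real_sqrt_ge_zero)
    qed (use r_L2(2) in simp)
    then show "(\<lambda>N. L2_norm m (\<lambda>x. exp_laplacian t (delta_fn y) x - S N x)) \<longlonglongrightarrow> 0"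
      by (simp add: r_def[abs_def])
  next
    fix g assume g: "g \<in> L2 m \<and> (\<lambda>N. L2_norm m (\<lambda>x. g x - S N x)) \<longlonglongrightarrow> 0"
    show "g = exp_laplacian t (delta_fn y)"
    proof
      fix x
      have "S N \<in> L2 m" for N
        using L2_diff[OF m e_L2 r_L2(1)[of N]] by (simp add: r_def)
      then have "sqrt (m x) * \<bar>g x - S N x\<bar> \<le> L2_norm m (\<lambda>x. g x - S N x)" for N
        using abs_le_L2_norm[where m = m and f = "\<lambda>x. g x - S N x", OF m L2_diff] m g by blast
      then have le: "norm (g x - S N x) \<le> L2_norm m (\<lambda>x. g x - S N x) * (1 / sqrt (m x))" for N
        using measure_pos[of x] by (simp add: field_simps)
      have lim: "(\<lambda>N. L2_norm m (\<lambda>x. g x - S N x) * (1 / sqrt (m x))) \<longlonglongrightarrow> 0"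
        using g by (intro tendsto_mult_left_zero) simp
      have "(\<lambda>N. g x - S N x) \<longlonglongrightarrow> 0"
        by (rule Lim_null_comparison[OF always_eventually[OF allI[OF le]] lim])
      then have "(\<lambda>N. g x - (g x - S N x)) \<longlonglongrightarrow> g x - 0"
        by (intro tendsto_diff tendsto_const)
      moreover have "(\<lambda>N. S N x) \<longlonglongrightarrow> exp_laplacian t (delta_fn y) x"
        using summable_LIMSEQ[OF sb(1), of x] by (simp add: S_def exp_laplacian_def b_def)
      ultimately show "g x = exp_laplacian t (delta_fn y) x"
        by (auto dest: LIMSEQ_unique)
    qed
  qed
qed

text \<open>Summing the exponential series against \<open>f\<close> over the vertices and over the powers of \<open>\<Delta>\<close>
  in either order gives the two sides; the order is irrelevant because the matrix of \<open>\<Delta>\<^sup>k\<close> has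
  absolute row sums at most \<open>(2 D)\<^sup>k\<close>.\<close>

lemma heat_eq_exp_laplacian:
  assumes f: "\<And>y. \<bar>f y\<bar> \<le> B"
  shows "heat w m t f x = exp_laplacian t f x"
proof -
  define h where "h k y = t ^ k / fact k * ((\<Delta> ^^ k) (delta_fn y) x * f y)" for k y
  have B: "0 \<le> B" using f[of x] by linarith
  define E where "E k = (2 * D * \<bar>t\<bar>) ^ k / fact k * B" for k :: nat
  have sE: "summable E"
    unfolding E_def using exp_sums by (intro summable_mult2) (auto simp: sums_iff)
  have row: "(\<Sum>y\<in>F. norm (h k y)) \<le> E k" if F: "finite F" for F k
  proof -
    have "(\<Sum>y\<in>F. norm (h k y)) \<le> (\<Sum>y\<in>F. \<bar>t\<bar> ^ k / fact k * (\<bar>(\<Delta> ^^ k) (delta_fn y) x\<bar> * B))"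
      using f by (intro sum_mono) (auto simp: h_def abs_mult power_abs intro!: mult_left_mono divide_right_mono)
    also have "\<dots> = \<bar>t\<bar> ^ k / fact k * ((\<Sum>y\<in>F. \<bar>(\<Delta> ^^ k) (delta_fn y) x\<bar>) * B)"
      by (simp add: sum_distrib_left sum_distrib_right)
    also have "\<dots> \<le> \<bar>t\<bar> ^ k / fact k * ((2 * D) ^ k * B)"
      using B by (intro mult_left_mono mult_right_mono sum_laplacian_power_row_le F) auto
    also have "\<dots> = E k" by (simp add: E_def power_mult_distrib mult_ac)
    finally show ?thesis .
  qed
  have row_summable: "(\<lambda>y. norm (h k y)) summable_on UNIV" for k
    by (rule nonneg_bdd_above_summable_on) (use row in \<open>auto intro!: bdd_aboveI\<close>)
  have "(\<lambda>k. \<Sum>\<^sub>\<infinity>y. norm (h k y)) summable_on UNIV"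
  proof (subst summable_on_UNIV_nonneg_real_iff)
    show "summable (\<lambda>k. \<Sum>\<^sub>\<infinity>y. norm (h k y))"
      by (rule summable_comparison_test'[OF sE])
         (use infsum_le_finite_sums[OF row_summable row] in \<open>auto simp: infsum_nonneg\<close>)
  qed (auto intro: infsum_nonneg)
  then have "(\<lambda>p. norm (case p of (k, y) \<Rightarrow> h k y)) summable_on UNIV \<times> UNIV"
    using row_summable by (subst Infinite_Sum.abs_summable_on_Sigma_iff) (auto simp: infsum_nonneg)
  then have swap: "(\<Sum>\<^sub>\<infinity>y. \<Sum>\<^sub>\<infinity>k. h k y) = (\<Sum>\<^sub>\<infinity>k. \<Sum>\<^sub>\<infinity>y. h k y)"
    by (rule infsum_swap_banach[OF abs_summable_summable, symmetric])
  have as_infsum: "exp_laplacian t g x = (\<Sum>\<^sub>\<infinity>k. t ^ k / fact k * (\<Delta> ^^ k) g x)"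
    if "\<And>y. \<bar>g y\<bar> \<le> C" for g C
    unfolding exp_laplacian_def
    by (rule infsumI[OF norm_summable_imp_has_sum, symmetric])
       (use summable_exp_laplacian_norm[where f = g, OF that, of t x]
         summable_exp_laplacian[where f = g, OF that, of t x] in \<open>simp_all add: summable_sums\<close>)
  have "heat w m t f x = (\<Sum>\<^sub>\<infinity>y. exp_laplacian t (delta_fn y) x * f y)"
    unfolding heat_def heat_kernel_def heat_L2_delta
    using measure_pos[THEN less_imp_neq] by (intro infsum_cong) simp
  also have "\<dots> = (\<Sum>\<^sub>\<infinity>y. \<Sum>\<^sub>\<infinity>k. h k y)"
  proof (rule infsum_cong)
    fix y
    have "exp_laplacian t (delta_fn y) x = (\<Sum>\<^sub>\<infinity>k. t ^ k / fact k * (\<Delta> ^^ k) (delta_fn y) x)"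
      by (rule as_infsum[where C = 1]) (simp add: indicator_def)
    then show "exp_laplacian t (delta_fn y) x * f y = (\<Sum>\<^sub>\<infinity>k. h k y)"
      unfolding h_def mult.assoc[symmetric] infsum_cmult_left' by simp
  qed
  also note swap
  also have "(\<Sum>\<^sub>\<infinity>k. \<Sum>\<^sub>\<infinity>y. h k y) = (\<Sum>\<^sub>\<infinity>k. t ^ k / fact k * (\<Delta> ^^ k) f x)"
    unfolding h_def infsum_cmult_right' infsumI[OF has_sum_laplacian_power] ..
  also have "\<dots> = exp_laplacian t f x"
    by (rule as_infsum[OF f, symmetric])
  finally show ?thesis .
qed

section \<open>Time integrals of the semigroup and the Kato constant\<close>

text \<open>Here \<open>R t = \<integral>\<^sub>0\<^sup>t P\<^sub>s f ds\<close>. Both \<open>\<Delta> (R t)\<close> and \<open>P\<^sub>t f\<close> have the time derivative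
  \<open>\<Delta> (P\<^sub>t f)\<close>, so their difference keeps its value \<open>- f\<close> at time \<open>0\<close>. In other words, \<open>R\<close> solves the
  heat equation with source \<open>f\<close>.\<close>

lemma exp_laplacian_primitive:
  assumes f: "\<And>y. \<bar>f y\<bar> \<le> B"
  obtains R where "\<And>x. R 0 x = 0"
    and "\<And>t x. 0 \<le> t \<Longrightarrow> t \<le> T \<Longrightarrow> ((\<lambda>t. R t x) has_real_derivative exp_laplacian t f x) (at t)"
    and "\<And>t x. 0 \<le> t \<Longrightarrow> t \<le> T \<Longrightarrow> \<Delta> (R t) x = exp_laplacian t f x - f x"
proof -
  note dP = exp_laplacian_has_derivative[where f = f, OF f]
  \<comment> \<open>Starting the integral at \<open>-1\<close> makes \<open>0\<close> an interior point, where the derivative is two-sided.\<close>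
  define I where "I t x = integral {-1..t} (\<lambda>s. exp_laplacian s f x)" for t x
  define R where "R t x = I t x - I 0 x" for t x
  have dR: "((\<lambda>t. R t x) has_real_derivative exp_laplacian t f x) (at t)" if "0 \<le> t" "t \<le> T" for t x
  proof -
    have "continuous_on {-1..T + 1} (\<lambda>s. exp_laplacian s f x)"
      using dP DERIV_continuous by (blast intro: continuous_at_imp_continuous_on)
    then have "((\<lambda>t. I t x) has_real_derivative exp_laplacian t f x) (at t within {-1..T + 1})"
      unfolding I_def by (rule integral_has_real_derivative) (use that in auto)
    moreover have "at t within {-1..T + 1} = at t"
      using that by (intro at_within_Icc_at) auto
    ultimately show ?thesis
      unfolding R_def by (auto intro!: derivative_eq_intros)
  qed
  have R0: "R 0 x = 0" for x by (simp add: R_def)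
  have "\<Delta> (R t) x = exp_laplacian t f x - f x" if t: "0 \<le> t" "t \<le> T" for t x
  proof -
    have der: "((\<lambda>t. \<Delta> (R t) x - exp_laplacian t f x) has_real_derivative 0) (at s)"
      if "0 \<le> s" "s \<le> t" for s
    proof -
      have "((\<lambda>t. \<Delta> (R t) x) has_real_derivative \<Delta> (exp_laplacian s f) x) (at s)"
        using that t by (intro laplacian_has_derivative dR) auto
      from DERIV_diff[OF this dP[of x]] show ?thesis by simp
    qed
    have "\<Delta> (R t) x - exp_laplacian t f x = \<Delta> (R 0) x - exp_laplacian 0 f x"
      by (intro antisym DERIV_nonneg_imp_nondecreasing[OF t(1)] DERIV_nonpos_imp_nonincreasing[OF t(1)])
         (use der in blast)+
    also have "\<dots> = - f x"
      using R0 by (simp add: exp_laplacian_0 laplacian_eq)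
    finally show ?thesis by simp
  qed
  with R0 dR show thesis by (rule that)
qed

text \<open>The semigroup retains the fraction \<open>exp (- D t)\<close> of the value at each vertex, so a large value of
  \<open>W\<close> at a single vertex already contributes to the Kato constant.\<close>

lemma bounded_if_k_T_finite:
  assumes "0 < T" "0 \<le> \<kappa>" and W: "\<And>x. 0 \<le> W x" and k: "k_T w m T W \<le> ennreal \<kappa>"
  shows "W x \<le> \<kappa> * exp (D * T) / T"
proof -
  define j where "j = nat \<lceil>W x\<rceil>"
  define V where "V z = min (real j) (W z)" for z
  have V: "0 \<le> V z" "V z \<le> real j" for z using W[of z] by (simp_all add: V_def)
  then have V_abs: "\<bar>V z\<bar> \<le> real j" for z by (simp add: abs_le_iff order_trans[OF _ V(1)])
  have Vx: "V x = W x" by (simp add: V_def j_def real_nat_ceiling_ge)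
  define c where "c = exp (- D * T) * W x"
  have "ennreal c \<le> sup_norm (heat w m s V)" if s: "0 \<le> s" "s \<le> T" for s
  proof -
    have "c \<le> exp (- D * s) * V x"
      unfolding c_def Vx using s D_nonneg W[of x] by (intro mult_right_mono) (auto intro: mult_left_mono)
    also have "\<dots> \<le> heat w m s V x"
      using exp_laplacian_lower_bound[OF V s(1)] heat_eq_exp_laplacian[where f = V, OF V_abs] by simp
    finally have "ennreal c \<le> ennreal \<bar>heat w m s V x\<bar>" by (intro ennreal_leI) simp
    also have "\<dots> \<le> sup_norm (heat w m s V)" unfolding sup_norm_def by (rule SUP_upper) simp
    finally show ?thesis .
  qed
  then have "(\<integral>\<^sup>+t\<in>{0..T}. ennreal c \<partial>lborel) \<le> (\<integral>\<^sup>+t\<in>{0..T}. sup_norm (heat w m t V) \<partial>lborel)"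
    by (intro nn_integral_mono) (auto simp: indicator_def)
  also have "\<dots> \<le> k_T w m T W"
    unfolding k_T_def V_def by (rule SUP_upper) simp
  also note k
  finally have "ennreal (c * T) \<le> ennreal \<kappa>"
    using \<open>0 < T\<close> W[of x] by (simp add: nn_integral_cmult_indicator ennreal_mult c_def)
  then have "c * T \<le> \<kappa>" using \<open>0 \<le> \<kappa>\<close> by simp
  then have "c \<le> \<kappa> / T" using \<open>0 < T\<close> by (simp add: field_simps)
  then have "exp (D * T) * c \<le> exp (D * T) * (\<kappa> / T)" by (rule mult_left_mono) simp
  moreover have "exp (D * T) * c = W x" unfolding c_def by (simp flip: mult.assoc exp_add)
  ultimately show ?thesis by (simp add: mult_ac)
qed

text \<open>The Kato constant is the time integral of the supremum over all vertices, hence at least the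
  time integral at any one vertex, which is \<open>R\<close> by the fundamental theorem of calculus. The cut-off
  \<open>j\<close> is chosen above the bound of \<open>W\<close>.\<close>

lemma primitive_le_k_T:
  assumes W: "\<And>x. 0 \<le> W x" "\<And>x. W x \<le> B" and "0 \<le> \<kappa>" and k: "k_T w m T W \<le> ennreal \<kappa>"
    and R: "R 0 = 0" "\<And>t. 0 \<le> t \<Longrightarrow> t \<le> T \<Longrightarrow> (R has_real_derivative exp_laplacian t W x) (at t)"
    and t: "0 \<le> t" "t \<le> T"
  shows "0 \<le> R t" "R t \<le> \<kappa>"
proof -
  have W_abs: "\<bar>W z\<bar> \<le> B" for z using W[of z] by simp
  have pos: "0 \<le> exp_laplacian s W x" if "0 \<le> s" for s by (rule exp_laplacian_nonneg[OF W that])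
  have "R 0 \<le> R t"
    by (rule DERIV_nonneg_imp_nondecreasing[OF t(1)]) (use R(2) pos t in \<open>meson order_trans\<close>)
  then show nonneg: "0 \<le> R t" using R(1) by simp
  define j where "j = nat \<lceil>B\<rceil>"
  have j: "(\<lambda>z. min (real j) (W z)) = W"
    using W(2) real_nat_ceiling_ge[of B] unfolding j_def
    by (intro ext min_absorb2) (blast intro: order_trans)
  have "continuous_on UNIV (\<lambda>s. exp_laplacian s W x)"
    using exp_laplacian_has_derivative[where f = W, OF W_abs] DERIV_continuous
    by (blast intro: continuous_at_imp_continuous_on)
  then have meas: "(\<lambda>s. exp_laplacian s W x) \<in> borel_measurable borel"
    by (rule borel_measurable_continuous_onI)
  have "ennreal (R t) = (\<integral>\<^sup>+s\<in>{0..t}. ennreal (exp_laplacian s W x) \<partial>lborel)"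
    using nn_integral_FTC_Icc[OF meas, of 0 t R] R pos t by simp
  also have "\<dots> \<le> (\<integral>\<^sup>+s\<in>{0..T}. sup_norm (heat w m s W) \<partial>lborel)"
  proof (intro nn_integral_mono)
    fix s
    have "ennreal (exp_laplacian s W x) \<le> ennreal \<bar>heat w m s W x\<bar>"
      by (simp add: heat_eq_exp_laplacian[where f = W, OF W_abs] ennreal_leI)
    also have "\<dots> \<le> sup_norm (heat w m s W)" unfolding sup_norm_def by (rule SUP_upper) simp
    finally show "ennreal (exp_laplacian s W x) * indicator {0..t} s
        \<le> sup_norm (heat w m s W) * indicator {0..T} s"
      using t by (auto simp: indicator_def)
  qed
  also have "\<dots> \<le> k_T w m T W"
    unfolding k_T_def by (rule SUP_upper2[of j]) (simp_all add: j)
  also note k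
  finally show "R t \<le> \<kappa>" using \<open>0 \<le> \<kappa>\<close> by simp
qed

section \<open>The gradient estimate\<close>

text \<open>The function \<open>U t = exp (2 K t) \<Gamma> (P\<^sub>t f)\<close> satisfies \<open>U' \<le> \<Delta> U + 2 W U\<close> by Bochner's formula.
  If \<open>M\<close> is its supremum over \<open>[0, T]\<close>, then \<open>c + 2 M R\<close> is a supersolution of the heat equation with
  source \<open>2 M W \<ge> 2 W U\<close>, so the maximum principle gives \<open>U \<le> c + 2 M R \<le> c + 2 M \<kappa>\<close>,
  hence \<open>M \<le> c + 2 M \<kappa>\<close>. This is Khas'minskii's argument with the semigroup of the
  Schroedinger operator \<open>\<Delta> + 2 W\<close> replaced by a supersolution.\<close>

lemma Gamma_exp_laplacian_le:
  assumes curv: "\<And>f x. bounded (range f) \<Longrightarrow> (K - W x) * \<Gamma> f x \<le> Gamma2 w m f f x"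
    and W: "\<And>x. 0 \<le> W x"
    and R0: "\<And>x. R 0 x = 0"
    and dR: "\<And>t x. 0 \<le> t \<Longrightarrow> t \<le> T \<Longrightarrow> ((\<lambda>t. R t x) has_real_derivative exp_laplacian t W x) (at t)"
    and LR: "\<And>t x. 0 \<le> t \<Longrightarrow> t \<le> T \<Longrightarrow> \<Delta> (R t) x = exp_laplacian t W x - W x"
    and R: "\<And>t x. 0 \<le> t \<Longrightarrow> t \<le> T \<Longrightarrow> 0 \<le> R t x" "\<And>t x. 0 \<le> t \<Longrightarrow> t \<le> T \<Longrightarrow> R t x \<le> \<kappa>"
    and \<kappa>: "2 * \<kappa> < 1" and "0 \<le> K"
    and f: "\<And>x. \<bar>f x\<bar> \<le> B"
    and c: "\<And>x. \<Gamma> f x \<le> c"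
    and t: "0 \<le> t" "t \<le> T"
  shows "exp (2 * K * t) * \<Gamma> (exp_laplacian t f) x \<le> c / (1 - 2 * \<kappa>)"
proof -
  define P where "P t = exp_laplacian t f" for t
  have B: "0 \<le> B" using f[of x] by linarith
  have P_abs: "\<bar>P t x\<bar> \<le> exp (2 * D * T) * B" if "0 \<le> t" "t \<le> T" for t x
  proof -
    have "\<bar>P t x\<bar> \<le> exp (2 * D * t) * B"
      using abs_exp_laplacian_le[where f = f, OF f, of t x] that by (simp add: P_def)
    also have "\<dots> \<le> exp (2 * D * T) * B"
      using that D_nonneg B by (intro mult_right_mono) (auto intro: mult_left_mono)
    finally show ?thesis .
  qed
  define U where "U t x = exp (2 * K * t) * \<Gamma> (P t) x" for t x
  have U_nonneg: "0 \<le> U t x" for t x by (simp add: U_def Gamma_nonneg)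
  have U_bdd: "U t x \<le> exp (2 * K * T) * (D / 2 * (2 * (exp (2 * D * T) * B))\<^sup>2)"
    if "0 \<le> t" "t \<le> T" for t x
    unfolding U_def
  proof (intro mult_mono Gamma_le)
    show "\<bar>P t y - P t x\<bar> \<le> 2 * (exp (2 * D * T) * B)" for y
      using P_abs[OF that, of y] P_abs[OF that, of x] by linarith
  qed (use that \<open>0 \<le> K\<close> B in \<open>auto intro: mult_left_mono Gamma_nonneg\<close>)
  define M where "M = (SUP (t, x) \<in> {0..T} \<times> UNIV. U t x)"
  have bdd: "bdd_above ((\<lambda>(t, x). U t x) ` ({0..T} \<times> UNIV))"
    using U_bdd by (fastforce intro: bdd_aboveI)
  have U_le_M: "U t x \<le> M" if "0 \<le> t" "t \<le> T" for t x
    using cSUP_upper[OF _ bdd, of "(t, x)"] that by (simp add: M_def)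
  have M: "0 \<le> M" using U_le_M[OF t, of x] U_nonneg[of t x] by linarith
  have U_le: "U t x \<le> c + 2 * M * R t x" if t: "0 \<le> t" "t \<le> T" for t x
  proof -
    define Z where "Z t x = U t x - c - 2 * M * R t x" for t x
    define Z' where "Z' t x = exp (2 * K * t) * (2 * K * \<Gamma> (P t) x + 2 * Gamma w m (P t) (\<Delta> (P t)) x)
        - 2 * M * exp_laplacian t W x" for t x
    have "Z t x \<le> 0"
    proof (rule maximum_principle[where Z = Z and Z' = Z' and T = T and B = "M - c"])
      fix s x assume s: "0 \<le> s" "s \<le> T"
      have "((\<lambda>s. \<Gamma> (P s) x) has_real_derivative 2 * Gamma w m (P s) (\<Delta> (P s)) x) (at s)"
        unfolding P_def by (intro Gamma_has_derivative exp_laplacian_has_derivative[where f = f, OF f])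
      then show "((\<lambda>t. Z t x) has_real_derivative Z' s x) (at s)"
        unfolding Z_def Z'_def U_def
        by (auto intro!: derivative_eq_intros dR s simp: algebra_simps)
      have "bounded (range (P s))"
        using P_abs[OF s] by (auto simp: bounded_iff)
      then have bochner: "2 * (K - W x) * \<Gamma> (P s) x \<le> \<Delta> (\<Gamma> (P s)) x - 2 * Gamma w m (P s) (\<Delta> (P s)) x"
        using curv[of "P s" x] by (simp add: Gamma2_def algebra_simps)
      have lap: "\<Delta> (Z s) x = exp (2 * K * s) * \<Delta> (\<Gamma> (P s)) x - 2 * M * (exp_laplacian s W x - W x)"
        unfolding Z_def U_def laplacian_diff laplacian_cmult laplacian_const LR[OF s] by simp
      have "Z' s x + 2 * M * exp_laplacian s W x
          \<le> exp (2 * K * s) * (\<Delta> (\<Gamma> (P s)) x + 2 * W x * \<Gamma> (P s) x)"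
        unfolding Z'_def diff_add_cancel using bochner by (intro mult_left_mono) (auto simp: algebra_simps)
      also have "\<dots> = exp (2 * K * s) * \<Delta> (\<Gamma> (P s)) x + 2 * (W x * U s x)"
        by (simp add: U_def algebra_simps)
      also have "\<dots> \<le> exp (2 * K * s) * \<Delta> (\<Gamma> (P s)) x + 2 * (W x * M)"
        using mult_left_mono[OF U_le_M[OF s, of x] W[of x]] by simp
      finally show "Z' s x \<le> \<Delta> (Z s) x"
        unfolding lap by (simp add: algebra_simps)
      have "0 \<le> M * R s x" using M R(1)[OF s] by simp
      then show "Z s x \<le> M - c"
        using U_le_M[OF s, of x] by (simp add: Z_def)
    next
      show "Z 0 x \<le> 0" for x
        using c[of x] by (simp add: Z_def U_def P_def R0 exp_laplacian_0[abs_def])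
    qed (use t in auto)
    then show ?thesis by (simp add: Z_def)
  qed
  have "M \<le> c + 2 * M * \<kappa>"
    unfolding M_def[symmetric]
  proof (subst M_def, rule cSUP_least)
    fix p :: "real \<times> 'v" assume "p \<in> {0..T} \<times> UNIV"
    then obtain s z where p: "p = (s, z)" "0 \<le> s" "s \<le> T" by auto
    have "M * R s z \<le> M * \<kappa>" using M R(2)[OF p(2,3)] by (intro mult_left_mono)
    then show "(case p of (t, x) \<Rightarrow> U t x) \<le> c + 2 * M * \<kappa>"
      using U_le[OF p(2,3), of z] by (simp add: p)
  qed (use t in auto)
  then have "M \<le> c / (1 - 2 * \<kappa>)" using \<kappa> by (simp add: field_simps)
  with U_le_M[OF t, of x] show ?thesis by (simp add: U_def P_def)
qed

end

lemma diff_le_of_exp_decay: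
  fixes F :: "real \<Rightarrow> real"
  assumes "0 < K" "0 \<le> T"
    and F: "\<And>t. 0 \<le> t \<Longrightarrow> t \<le> T \<Longrightarrow> (F has_real_derivative F' t) (at t)"
    and F': "\<And>t. 0 \<le> t \<Longrightarrow> t \<le> T \<Longrightarrow> \<bar>F' t\<bar> \<le> C * exp (- K * t)"
  shows "\<bar>F T - F 0\<bar> \<le> C / K * (1 - exp (- K * T))"
proof -
  have le: "s * (F T - F 0) \<le> C / K * (1 - exp (- K * T))" if "\<bar>s\<bar> = 1" for s
  proof -
    have "s * F 0 + C / K * exp (- K * 0) \<ge> s * F T + C / K * exp (- K * T)"
    proof (rule DERIV_nonpos_imp_nonincreasing[OF \<open>0 \<le> T\<close>])
      fix t assume t: "0 \<le> t" "t \<le> T"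
      have "((\<lambda>t. s * F t + C / K * exp (- K * t)) has_real_derivative
          s * F' t - C * exp (- K * t)) (at t)"
        using \<open>0 < K\<close> by (auto intro!: derivative_eq_intros F t)
      moreover have "\<bar>s * F' t\<bar> \<le> C * exp (- K * t)"
        using F'[OF t] that by (simp add: abs_mult)
      ultimately show "\<exists>y. ((\<lambda>t. s * F t + C / K * exp (- K * t)) has_real_derivative y) (at t) \<and> y \<le> 0"
        by (intro exI conjI) (assumption, linarith)
    qed
    then show ?thesis by (simp add: algebra_simps)
  qed
  show ?thesis using le[of 1] le[of "- 1"] by (simp add: abs_le_iff)
qed

context bounded_degree_graph
begin

section \<open>The diameter bound\<close>

lemma comb_dist_path:
  obtains p where "p 0 = x" "p (comb_dist w x y) = y"
    "\<And>i. i \<in> {1..comb_dist w x y} \<Longrightarrow> 0 < w (p i) (p (i - 1))"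
proof -
  have "\<exists>p. p 0 = x \<and> p (comb_dist w x y) = y \<and> (\<forall>i\<in>{1..comb_dist w x y}. 0 < w (p i) (p (i - 1)))"
    unfolding comb_dist_def using connected[of x y] by (rule LeastI_ex)
  with that show thesis by blast
qed

lemma comb_dist_le:
  assumes "p 0 = x" "p n = y" "\<And>i. i \<in> {1..n} \<Longrightarrow> 0 < w (p i) (p (i - 1))"
  shows "comb_dist w x y \<le> n"
  unfolding comb_dist_def by (rule Least_le) (use assms in blast)

lemma comb_dist_refl: "comb_dist w x x = 0"
  using comb_dist_le[of "\<lambda>_. x" x 0 x] by simp

lemma comb_dist_edge_le:
  assumes "0 < w x y"
  shows "comb_dist w z y \<le> comb_dist w z x + 1"
proof -
  obtain p where p: "p 0 = z" "p (comb_dist w z x) = x"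
    "\<And>i. i \<in> {1..comb_dist w z x} \<Longrightarrow> 0 < w (p i) (p (i - 1))"
    using comb_dist_path[of z x] by blast
  define p' where "p' i = (if i \<le> comb_dist w z x then p i else y)" for i
  show ?thesis
  proof (rule comb_dist_le[of p'])
    fix i assume "i \<in> {1..comb_dist w z x + 1}"
    then consider "i \<in> {1..comb_dist w z x}" | "i = Suc (comb_dist w z x)" by fastforce
    then show "0 < w (p' i) (p' (i - 1))"
    proof cases
      case 1
      then have "p' i = p i" "p' (i - 1) = p (i - 1)" by (auto simp: p'_def)
      with p(3)[OF 1] show ?thesis by simp
    qed (use assms weight_sym[of x y] in \<open>simp add: p'_def p(2)\<close>)
  qed (use p in \<open>auto simp: p'_def\<close>)
qed

text \<open>With \<open>a = exp (- K T / 2)\<close> and \<open>\<kappa> = (1 - a) / 4\<close> one has \<open>1 - 2 \<kappa> = (1 + a) / 2\<close>, so the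
  gradient estimate reads \<open>\<Gamma> (P\<^sub>t f) \<le> 2 / (1 + a) exp (- 2 K t) sup (\<Gamma> f)\<close>. At time \<open>T\<close> the factor
  is \<open>2 a\<^sup>4 / (1 + a) \<le> a\<^sup>2\<close>. Since \<open>\<bar>\<partial>\<^sub>t P\<^sub>t f\<bar>\<^sup>2 \<le> 2 D \<Gamma> (P\<^sub>t f)\<close>, integrating its
  square root over \<open>[0, T]\<close> controls the displacement.\<close>

lemma semigroup_step:
  fixes T K a b :: real
  defines "a \<equiv> exp (- K * T / 2)"
  assumes "0 < K" "0 < T"
    and grad: "\<And>t x. 0 \<le> t \<Longrightarrow> t \<le> T \<Longrightarrow>
      exp (2 * K * t) * \<Gamma> (exp_laplacian t f) x \<le> D / 2 * b\<^sup>2 * (2 / (1 + a))"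
    and f: "\<And>x. \<bar>f x\<bar> \<le> B" and "0 \<le> b"
  shows "\<Gamma> (exp_laplacian T f) x \<le> D / 2 * (a * b)\<^sup>2"
    and "\<bar>exp_laplacian T f x - f x\<bar> \<le> 2 * D * b * (1 - a) / K"
proof -
  have a: "0 < a" "a < 1" using assms(2,3) by (auto simp: a_def)
  have grad': "\<Gamma> (exp_laplacian t f) x \<le> D / 2 * b\<^sup>2 * (2 / (1 + a)) * (exp (- K * t))\<^sup>2"
    if "0 \<le> t" "t \<le> T" for t x
  proof -
    have "exp (- 2 * K * t) * (exp (2 * K * t) * \<Gamma> (exp_laplacian t f) x)
        \<le> exp (- 2 * K * t) * (D / 2 * b\<^sup>2 * (2 / (1 + a)))"
      by (intro mult_left_mono grad that) simp
    moreover have "exp (- 2 * K * t) * (exp (2 * K * t) * \<Gamma> (exp_laplacian t f) x) = \<Gamma> (exp_laplacian t f) x"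
      by (simp flip: mult.assoc exp_add)
    moreover have "exp (- 2 * K * t) = (exp (- K * t))\<^sup>2"
      by (simp flip: exp_double)
    ultimately show ?thesis by (metis mult.commute)
  qed
  have aT: "exp (- K * T) = a\<^sup>2" unfolding a_def by (simp flip: exp_double)
  have "2 / (1 + a) * a\<^sup>2 \<le> 1"
  proof -
    have "a * a \<le> a" using a by (intro mult_left_le) auto
    then have "2 * (a * a) \<le> 1 + a" using a by linarith
    then show ?thesis using a by (simp add: field_simps power2_eq_square)
  qed
  then have "(D / 2 * b\<^sup>2 * a\<^sup>2) * (2 / (1 + a) * a\<^sup>2) \<le> (D / 2 * b\<^sup>2 * a\<^sup>2) * 1"
    using D_nonneg by (intro mult_left_mono) auto
  then have "D / 2 * b\<^sup>2 * (2 / (1 + a)) * (a\<^sup>2)\<^sup>2 \<le> D / 2 * (a * b)\<^sup>2"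
    by (simp add: power2_eq_square mult_ac)
  moreover have "\<Gamma> (exp_laplacian T f) x \<le> D / 2 * b\<^sup>2 * (2 / (1 + a)) * (a\<^sup>2)\<^sup>2"
    using grad'[of T x] \<open>0 < T\<close> unfolding aT by simp
  ultimately show "\<Gamma> (exp_laplacian T f) x \<le> D / 2 * (a * b)\<^sup>2" by linarith
  have "\<bar>exp_laplacian T f x - exp_laplacian 0 f x\<bar> \<le> D * b * (2 / (1 + a)) / K * (1 - exp (- K * T))"
  proof (rule diff_le_of_exp_decay[where F' = "\<lambda>t. \<Delta> (exp_laplacian t f) x"])
    show "((\<lambda>t. exp_laplacian t f x) has_real_derivative \<Delta> (exp_laplacian t f) x) (at t)" for t
      by (rule exp_laplacian_has_derivative[where f = f, OF f])
    fix t assume t: "0 \<le> t" "t \<le> T"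
    have "(\<Delta> (exp_laplacian t f) x)\<^sup>2 \<le> 2 * D * (D / 2 * b\<^sup>2 * (2 / (1 + a)) * (exp (- K * t))\<^sup>2)"
      using laplacian_square_le mult_left_mono[OF grad'[OF t]] D_nonneg
      by (meson mult_nonneg_nonneg order_trans zero_le_numeral)
    \<comment> \<open>As \<open>2 / (1 + a) \<ge> 1\<close>, squaring this factor only loses a little and removes the root; the
      factor \<open>1 + a\<close> then cancels against \<open>1 - a\<^sup>2\<close> in the integral.\<close>
    also have "\<dots> = (D * b * exp (- K * t))\<^sup>2 * (2 / (1 + a))"
      by (simp add: power2_eq_square)
    also have "\<dots> \<le> (D * b * exp (- K * t))\<^sup>2 * (2 / (1 + a))\<^sup>2"
      using a by (intro mult_left_mono self_le_power) (auto simp: field_simps)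
    also have "\<dots> = (D * b * (2 / (1 + a)) * exp (- K * t))\<^sup>2"
      by (simp add: power2_eq_square)
    finally have "\<bar>\<Delta> (exp_laplacian t f) x\<bar> \<le> \<bar>D * b * (2 / (1 + a)) * exp (- K * t)\<bar>"
      by (simp only: abs_le_square_iff)
    then show "\<bar>\<Delta> (exp_laplacian t f) x\<bar> \<le> D * b * (2 / (1 + a)) * exp (- K * t)"
      using a D_nonneg \<open>0 \<le> b\<close> by (simp add: abs_of_nonneg)
  qed (use assms in auto)
  also have "\<dots> = 2 * D * b * (1 - a) / K * ((1 + a) / (1 + a))"
  proof -
    have "1 - a\<^sup>2 = (1 - a) * (1 + a)" by (simp add: power2_eq_square algebra_simps)
    then show ?thesis unfolding aT by simp
  qed
  finally show "\<bar>exp_laplacian T f x - f x\<bar> \<le> 2 * D * b * (1 - a) / K"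
    using a by (simp add: exp_laplacian_0)
qed

text \<open>Iterating the step, the displacements form a geometric series with sum \<open>2 D / K\<close>, while
  the gradient tends to \<open>0\<close>. As the graph is connected, the iterates become constant along
  every path, and any two values of \<open>f\<close> are therefore at most \<open>4 D / K\<close> apart.\<close>

lemma oscillation_le:
  fixes T K :: real
  defines "a \<equiv> exp (- K * T / 2)"
  assumes "0 < K" "0 < T"
    and grad: "\<And>f c B t x. (\<And>x. \<bar>f x\<bar> \<le> B) \<Longrightarrow> (\<And>x. \<Gamma> f x \<le> c) \<Longrightarrow> 0 \<le> t \<Longrightarrow> t \<le> T \<Longrightarrow>
      exp (2 * K * t) * \<Gamma> (exp_laplacian t f) x \<le> c * (2 / (1 + a))"
    and f: "\<And>x. \<bar>f x\<bar> \<le> B" "\<And>x. \<Gamma> f x \<le> D / 2"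
  shows "\<bar>f x - f y\<bar> \<le> 4 * D / K"
proof -
  have a: "0 < a" "a < 1" using assms(2,3) by (auto simp: a_def)
  define F where "F k = (exp_laplacian T ^^ k) f" for k
  have F_Suc: "F (Suc k) = exp_laplacian T (F k)" for k by (simp add: F_def)
  have F_bdd: "\<exists>B. \<forall>x. \<bar>F k x\<bar> \<le> B" for k
  proof (induction k)
    case (Suc k)
    then obtain B where "\<And>x. \<bar>F k x\<bar> \<le> B" by blast
    from abs_exp_laplacian_le[where f = "F k", OF this] show ?case unfolding F_Suc by blast
  qed (use f in \<open>auto simp: F_def\<close>)
  have step: "(\<forall>x. \<Gamma> (F (Suc k)) x \<le> D / 2 * (a * a ^ k)\<^sup>2) \<and>
      (\<forall>x. \<bar>F (Suc k) x - F k x\<bar> \<le> 2 * D * a ^ k * (1 - a) / K)"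
    if "\<And>x. \<Gamma> (F k) x \<le> D / 2 * (a ^ k)\<^sup>2" for k
  proof -
    obtain B where B: "\<And>x. \<bar>F k x\<bar> \<le> B" using F_bdd[of k] by blast
    note g = grad[where f = "F k", OF B that]
    show ?thesis
      unfolding F_Suc a_def
      by (intro allI conjI semigroup_step[where f = "F k", OF \<open>0 < K\<close> \<open>0 < T\<close> g[unfolded a_def] B]) auto
  qed
  have F_grad: "\<Gamma> (F k) x \<le> D / 2 * (a ^ k)\<^sup>2" for k x
  proof (induction k arbitrary: x)
    case (Suc k)
    show ?case using step[OF Suc.IH] by simp
  qed (use f in \<open>simp add: F_def\<close>)
  have F_near: "\<bar>F k x - f x\<bar> \<le> 2 * D / K * (1 - a ^ k)" for k x
  proof (induction k)
    case (Suc k)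
    have "\<bar>F (Suc k) x - F k x\<bar> \<le> 2 * D / K * (a ^ k * (1 - a))"
      using step[OF F_grad, of k] by (simp add: mult_ac)
    then have "\<bar>F (Suc k) x - f x\<bar> \<le> 2 * D / K * (a ^ k * (1 - a)) + 2 * D / K * (1 - a ^ k)"
      using Suc.IH by linarith
    also have "\<dots> = 2 * D / K * (1 - a ^ Suc k)" by (simp add: algebra_simps add_divide_distrib diff_divide_distrib)
    finally show ?case .
  qed (simp add: F_def)
  have edge: "(\<lambda>k. F k v - F k u) \<longlonglongrightarrow> 0" if "0 < w u v" for u v
  proof -
    have q: "0 < q u v" using that measure_pos[of u] by (simp add: rate_def)
    have le: "norm ((F k v - F k u)\<^sup>2) \<le> D / q u v * (a\<^sup>2) ^ k" for k
    proof -
      have "q u v * (F k v - F k u)\<^sup>2 \<le> D * (a ^ k)\<^sup>2"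
        using edge_le_Gamma[OF that, of "F k"] F_grad[of k u] by simp
      then show ?thesis using q by (simp add: field_simps flip: power_mult)
    qed
    have "a\<^sup>2 < 1" using a by (simp add: power_less_one_iff)
    then have lim: "(\<lambda>k. D / q u v * (a\<^sup>2) ^ k) \<longlonglongrightarrow> 0"
      by (intro tendsto_mult_right_zero LIMSEQ_power_zero) simp
    have "(\<lambda>k. (F k v - F k u)\<^sup>2) \<longlonglongrightarrow> 0"
      by (rule Lim_null_comparison[OF always_eventually[OF allI[OF le]] lim])
    then show ?thesis by simp
  qed
  obtain p where p: "p 0 = y" "p (comb_dist w y x) = x"
    "\<And>i. i \<in> {1..comb_dist w y x} \<Longrightarrow> 0 < w (p i) (p (i - 1))"
    using comb_dist_path[of y x] by blast
  have "(\<lambda>k. F k (p i) - F k y) \<longlonglongrightarrow> 0" if "i \<le> comb_dist w y x" for i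
    using that
  proof (induction i)
    case (Suc i)
    have "0 < w (p i) (p (Suc i))" using p(3)[of "Suc i"] Suc.prems by (simp add: weight_sym)
    from tendsto_add[OF edge[OF this] Suc.IH] Suc.prems show ?case by simp
  qed (simp add: p)
  from this[OF order_refl] have "(\<lambda>k. F k x - F k y) \<longlonglongrightarrow> 0" by (simp add: p)
  then have "(\<lambda>k. 4 * D / K + \<bar>F k x - F k y\<bar>) \<longlonglongrightarrow> 4 * D / K + \<bar>0\<bar>"
    by (intro tendsto_intros)
  moreover have "\<bar>f x - f y\<bar> \<le> 4 * D / K + \<bar>F k x - F k y\<bar>" for k
  proof -
    have "2 * D / K * (1 - a ^ k) \<le> 2 * D / K * 1"
      using a D_nonneg \<open>0 < K\<close> by (intro mult_left_mono) auto
    moreover have "4 * D / K = 2 * D / K + 2 * D / K" by simp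
    ultimately show ?thesis using F_near[of k x] F_near[of k y] by linarith
  qed
  ultimately show ?thesis
    by (intro LIMSEQ_le_const[where X = "\<lambda>k. 4 * D / K + \<bar>F k x - F k y\<bar>"]) auto
qed

theorem comb_dist_le_of_Kato_curvature:
  fixes \<rho> :: "'v \<Rightarrow> real" and T K :: real
  assumes "0 < T" "0 < K"
    and curv: "\<And>f x. bounded (range f) \<Longrightarrow> \<rho> x * \<Gamma> f x \<le> Gamma2 w m f f x"
    and kato: "k_T w m T (\<lambda>x. neg_part (\<rho> x - K)) \<le> ennreal (1 / 4 * (1 - exp (- K * T / 2)))"
  shows "real (comb_dist w x y) \<le> 4 * D / K"
proof -
  define W where "W x = neg_part (\<rho> x - K)" for x
  define a where "a = exp (- K * T / 2)"
  define \<kappa> where "\<kappa> = 1 / 4 * (1 - a)"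
  have a: "0 < a" "a < 1" using assms(1,2) by (auto simp: a_def)
  then have \<kappa>: "0 \<le> \<kappa>" "2 * \<kappa> < 1" and \<kappa>_a: "1 - 2 * \<kappa> = (1 + a) / 2"
    by (auto simp: \<kappa>_def field_simps)
  have kT: "k_T w m T W \<le> ennreal \<kappa>" using kato by (simp add: W_def[abs_def] \<kappa>_def a_def)
  have W: "0 \<le> W z" for z by (simp add: W_def neg_part_def)
  define C where "C = \<kappa> * exp (D * T) / T"
  have W_le: "W z \<le> C" for z
    unfolding C_def by (rule bounded_if_k_T_finite[OF \<open>0 < T\<close> \<kappa>(1) W kT])
  have W_abs: "\<bar>W z\<bar> \<le> C" for z using W[of z] W_le[of z] by simp
  obtain R where R: "\<And>x. R 0 x = 0"
    "\<And>t x. 0 \<le> t \<Longrightarrow> t \<le> T \<Longrightarrow> ((\<lambda>t. R t x) has_real_derivative exp_laplacian t W x) (at t)"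
    "\<And>t x. 0 \<le> t \<Longrightarrow> t \<le> T \<Longrightarrow> \<Delta> (R t) x = exp_laplacian t W x - W x"
    using exp_laplacian_primitive[where f = W and T = T, OF W_abs] by blast
  have R_le: "0 \<le> R t z" "R t z \<le> \<kappa>" if "0 \<le> t" "t \<le> T" for t z
    using primitive_le_k_T[where W = W and R = "\<lambda>t. R t z", OF W W_le \<kappa>(1) kT R(1) R(2) that] by auto
  have curv_W: "(K - W x) * \<Gamma> f x \<le> Gamma2 w m f f x" if "bounded (range f)" for f x
  proof -
    have "K - W x \<le> \<rho> x" by (simp add: W_def neg_part_def)
    then have "(K - W x) * \<Gamma> f x \<le> \<rho> x * \<Gamma> f x" by (intro mult_right_mono Gamma_nonneg)
    with curv[OF that, of x] show ?thesis by linarith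
  qed
  have grad: "exp (2 * K * t) * \<Gamma> (exp_laplacian t f) z \<le> c * (2 / (1 + a))"
    if "\<And>x. \<bar>f x\<bar> \<le> B" "\<And>x. \<Gamma> f x \<le> c" "0 \<le> t" "t \<le> T" for f c B t z
    using Gamma_exp_laplacian_le[where W = W and R = R and f = f, OF curv_W W R R_le \<kappa>(2) _ that]
      \<open>0 < K\<close> by (simp add: \<kappa>_a)
  \<comment> \<open>Truncating the distance function at \<open>N\<close> makes it bounded and keeps its value at \<open>y\<close>.\<close>
  define N where "N = comb_dist w x y"
  define f where "f z = real (min (comb_dist w x z) N)" for z
  have "\<bar>f x - f y\<bar> \<le> 4 * D / K"
  proof (rule oscillation_le[OF \<open>0 < K\<close> \<open>0 < T\<close> grad[unfolded a_def]])
    show "\<bar>f z\<bar> \<le> real N" for z by (simp add: f_def)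
    have "\<bar>f v - f u\<bar> \<le> 1" if "0 < w u v" for u v
      using comb_dist_edge_le[OF that, of x] comb_dist_edge_le[of v u x] that
      by (simp add: f_def weight_sym)
    then show "\<Gamma> f z \<le> D / 2" for z using Gamma_le[of z f 1] by simp
  qed
  then show ?thesis by (simp add: f_def N_def comb_dist_refl)
qed

end

theorem theorem5p1:
  fixes w :: "'v::countable \<Rightarrow> 'v \<Rightarrow> real" and m :: "'v \<Rightarrow> real"
    and \<rho> :: "'v \<Rightarrow> real" and T K :: real and n :: ereal
  assumes "0 < T" and "0 < K" and "0 < n"
    and "measured_weighted_graph w m"
    and "Deg_max w m < \<infinity>"
    and "CD w m \<rho> n"
    and "k_T w m T (\<lambda>x. neg_part (\<rho> x - K)) \<le> ennreal (1 / 4 * (1 - exp (- K * T / 2)))"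
  shows "diam w \<le> 4 * Deg_max w m * ereal (exp (K * T / 2)) / ereal K"
proof -
  have Deg_le: "ereal (Deg w m x) \<le> Deg_max w m" for x
    unfolding Deg_max_def by (rule SUP_upper) simp
  then have "Deg_max w m \<noteq> - \<infinity>" by (metis MInfty_neq_ereal(1) ereal_infty_less_eq(2))
  then obtain D where D: "Deg_max w m = ereal D" using assms(5) by (cases "Deg_max w m") auto
  interpret measured_weighted_graph w m by (rule assms(4))
  interpret bounded_degree_graph w m D
    by unfold_locales (use Deg_le D in simp)
  have "\<rho> x * \<Gamma> f x \<le> Gamma2 w m f f x" if "bounded (range f)" for f x
  proof -
    have "0 \<le> 1 / n" using \<open>0 < n\<close> by (cases n) auto
    then have "0 \<le> 1 / n * ereal ((\<Delta> f x)\<^sup>2)" by (rule ereal_0_le_mult) simp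
    then have "ereal (\<rho> x * \<Gamma> f x) \<le> ereal (\<rho> x * \<Gamma> f x) + 1 / n * ereal ((\<Delta> f x)\<^sup>2)"
      by (rule ereal_le_add_self)
    also have "\<dots> \<le> ereal (Gamma2 w m f f x)"
      using assms(6) that by (simp add: CD_def)
    finally show ?thesis by simp
  qed
  then have "real (comb_dist w x y) \<le> 4 * D / K" for x y
    by (rule comb_dist_le_of_Kato_curvature[OF assms(1,2) _ assms(7)])
  also have "4 * D / K \<le> 4 * D * exp (K * T / 2) / K"
    using assms(1,2) D_nonneg by (intro divide_right_mono mult_le_cancel_left1[THEN iffD2]) auto
  finally have "diam w \<le> ereal (4 * D * exp (K * T / 2) / K)"
    unfolding diam_def by (intro SUP_least) simp
  then show ?thesis using \<open>0 < K\<close> by (simp add: D)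
qed

end
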